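(* Let $\Omega\subset\mathbb{C}$ be a bounded connected open set, $\varphi:\mathbb{D}\to\Omega$ an analytic covering map and $\overline{\varphi}$ its extension by radial limits. Let $p,q\in\overline\Omega$, $z\in\Omega$, and $\widehat z\in\mathbb{D}$ with $\varphi(\widehat z)=z$. (1) If $\gamma$ is a path in $\Omega$ (e.p.e.) joining $p$ and $q$ with $\gamma(s_0)=z$ for some $s_0\in[0,1]$, then there is a unique path $\widehat\gamma$ in $\mathbb{D}$ (e.p.e.) with $\overline{\varphi}\circ\widehat\gamma=\gamma$ and $\widehat\gamma(s_0)=\widehat z$. (2) If $h:[0,1]\times[0,1]\to\mathbb{C}$ is continuous such that for every $t\in[0,1]$ the path $h_t=h(\cdot,t)$ is a path in $\Omega$ (e.p.e.) joining $p$ and $q$, and $h(s_0,0)=z$ for some $s_0\in[0,1]$, then there is a unique continuous $\widehat h:[0,1]\times[0,1]\to\overline{\mathbb{D}}$ such that $\widehat h(s,t)\in\mathbb{D}$ and $\varphi(\widehat h(s,t))=h(s,t)$ for all $(s,t)\in(0,1)\times[0,1]$, $\widehat h(\{0\}\times[0,1])$ is a single point $\widehat p$ with $\overline\varphi(\widehat p)=p$, $\widehat h(\{1\}\times[0,1])$ is a single point $\widehat q$ with $\overline\varphi(\widehat q)=q$, and $\widehat h(s_0,0)=\widehat z$.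
   Context: $\mathbb{D}=\{z\in\mathbb{C}:|z|<1\}$. A path in $\Omega$ (e.p.e.) joining $p$ and $q$ is a continuous $\gamma:[0,1]\to\mathbb{C}$ with $\gamma(0)=p$, $\gamma(1)=q$, $\gamma((0,1))\subset\Omega$; similarly for paths in $\mathbb{D}$ (e.p.e.). The extended covering map $\overline\varphi$ is defined on $\mathbb{D}\cup\{\alpha\in\partial\mathbb{D}:\lim_{r\to1^-}\varphi(r\alpha)\text{ exists}\}$ by $\overline\varphi=\varphi$ on $\mathbb{D}$ and $\overline\varphi(\alpha)=\lim_{r\to1^-}\varphi(r\alpha)$ for such $\alpha\in\partial\mathbb{D}$ (not necessarily continuous at points of $\partial\mathbb{D}$). *)

theory Defs
  imports "HOL-Complex_Analysis.Complex_Analysis"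
begin

definition path_epe :: "complex set \<Rightarrow> complex \<Rightarrow> complex \<Rightarrow> (real \<Rightarrow> complex) \<Rightarrow> bool" where
  "path_epe S p q g \<longleftrightarrow> continuous_on {0..1} g \<and> g 0 = p \<and> g 1 = q \<and> g ` {0<..<1} \<subseteq> S"

definition ext_dom :: "(complex \<Rightarrow> complex) \<Rightarrow> complex set" where
  "ext_dom \<phi> = ball 0 1 \<union>
     {\<alpha>. cmod \<alpha> = 1 \<and> (\<exists>l. ((\<lambda>r::real. \<phi> (of_real r * \<alpha>)) \<longlongrightarrow> l) (at_left 1))}"

definition ext_phi :: "(complex \<Rightarrow> complex) \<Rightarrow> complex \<Rightarrow> complex" where
  "ext_phi \<phi> w = (if w \<in> ball 0 1 then \<phi> w
                   else Lim (at_left 1) (\<lambda>r::real. \<phi> (of_real r * w)))"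

end

theory Submission
  imports Defs
begin

text \<open>
  Away from the endpoints the lift comes from covering theory on a convex strip, so the point is its
  behaviour as the path approaches an endpoint \<open>p\<close> outside \<open>\<Omega>\<close>. There the lift can accumulate only
  on the unit circle. Two distinct accumulation points would give arcs in the disc joining
  neighbourhoods of these points along which \<open>\<phi> - p\<close> tends to \<open>0\<close>, forcing \<open>\<phi>\<close> to be constant
  (Koebe); hence the lift converges to one boundary point, and the radial limit of \<open>\<phi>\<close> there is \<open>p\<close>
  (Lindelof). Both classical facts follow, by Moebius maps, from one estimate: a function bounded by
  \<open>1\<close> that is small on a path from near \<open>-1\<close> to near \<open>1\<close> is small at \<open>0\<close>. The estimate holds because
  up to gaps near \<open>-1\<close> and \<open>1\<close>, the path and its reflection separate \<open>0\<close> from the circle, so the maximum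
  principle applies to \<open>f z * cnj (f (cnj z))\<close>. Part (1) is the case of a constant homotopy in (2).
\<close>

subsection \<open>A two-constants estimate\<close>

text \<open>The Fashoda meet theorem for \<open>real^2\<close>, carried to the complex plane by the
  continuous injection \<open>v\<close> that reads off real and imaginary part.\<close>

lemma fashoda_complex:
  fixes f g :: "real \<Rightarrow> complex"
  assumes "path f" "path g" "path_image f \<subseteq> cbox a b" "path_image g \<subseteq> cbox a b"
    and "Re (pathstart f) = Re a" "Re (pathfinish f) = Re b"
    and "Im (pathstart g) = Im a" "Im (pathfinish g) = Im b"
  obtains z where "z \<in> path_image f" "z \<in> path_image g"
proof -
  define v :: "complex \<Rightarrow> real^2" where "v = (\<lambda>z. \<chi> i. if i = 1 then Re z else Im z)"
  have v1: "v z $ 1 = Re z" and v2: "v z $ 2 = Im z" for z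
    by (auto simp: v_def)
  have "continuous_on S v" for S
    unfolding v_def
  proof (rule continuous_on_vec_lambda)
    show "continuous_on S (\<lambda>z. if i = 1 then Re z else Im z)" for i :: 2
      by (cases "i = 1") (auto intro!: continuous_intros)
  qed
  then have "path (v \<circ> f)" "path (v \<circ> g)"
    using assms by (auto intro: path_continuous_image)
  moreover have "v ` cbox a b \<subseteq> cbox (v a) (v b)"
    by (auto simp: mem_box_cart forall_2 v1 v2 in_cbox_complex_iff)
  then have "path_image (v \<circ> f) \<subseteq> cbox (v a) (v b)" "path_image (v \<circ> g) \<subseteq> cbox (v a) (v b)"
    using assms unfolding path_image_compose by blast+
  ultimately obtain x where "x \<in> path_image (v \<circ> f)" "x \<in> path_image (v \<circ> g)"
    by (rule fashoda) (use assms in \<open>auto simp: pathstart_compose pathfinish_compose v1 v2\<close>)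
  moreover have "inj v"
    by (rule injI) (metis complex_eqI v1 v2)
  ultimately show ?thesis
    unfolding path_image_compose by (metis imageE injD that)
qed

text \<open>Together with its mirror image, \<open>c\<close> is a barrier between \<open>0\<close>
  and the circle, open only near \<open>-1\<close> and \<open>1\<close>. Assumption
  \<open>far\<close> keeps \<open>g\<close> out of these gaps, while \<open>outer\<close> and
  \<open>close\<close> say that \<open>g\<close> ends beyond the barrier and so near the circle that
  it can be prolonged without reaching a gap.\<close>

lemma crossing_paths_in_disc:
  fixes c g :: "real \<Rightarrow> complex"
  assumes c: "path c" "path_image c \<subseteq> ball 0 1"
    and c0: "dist (pathstart c) (-1) < d" and c1: "dist (pathfinish c) 1 < d"
    and g: "path g" "path_image g \<subseteq> ball 0 1" "pathstart g = 0"
    and far: "\<And>y. y \<in> path_image g \<Longrightarrow> dist y 1 \<ge> 2 * d \<and> dist y (-1) \<ge> 2 * d"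
    and outer: "\<And>x. x \<in> path_image c \<Longrightarrow> cmod x < cmod (pathfinish g)"
    and close: "1 - d < cmod (pathfinish g)"
  obtains x y where "x \<in> path_image c" "y \<in> path_image g" "x = y \<or> x = cnj y"
proof -
  \<comment> \<open>Fold both paths into the upper half disc by \<open>u\<close>. Prolong the folded \<open>c\<close> to \<open>-1\<close> and \<open>1\<close>, and
    the folded \<open>g\<close> radially to the circle and then vertically to height \<open>1\<close>: the prolonged paths
    cross a rectangle, and the bounds on \<open>d\<close> keep the added pieces from meeting anything.\<close>
  define u where "u z = Complex (Re z) \<bar>Im z\<bar>" for z
  have u_cont: "continuous_on S u" for S
    unfolding u_def Complex_eq by (intro continuous_intros)
  have u_norm: "cmod (u z) = cmod z" for z
    by (simp add: u_def cmod_def)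
  have u_dist: "dist (u z) (of_real r) = dist z (of_real r)" for z r
    by (simp add: u_def dist_norm cmod_def)
  have u_eq: "x = y \<or> x = cnj y" if "u x = u y" for x y
    using that by (auto simp: u_def complex_eq_iff abs_eq_iff)
  have dpos: "d > 0" using c0 by (meson le_less_trans zero_le_dist)
  define w where "w = u (pathfinish g)"
  have wlt: "cmod w < 1" 
    using g(2) pathfinish_in_path_image[of g] by (auto simp: w_def u_norm)
  have wpos: "cmod w > 0"
    using outer[OF pathstart_in_path_image] norm_ge_zero le_less_trans
    unfolding w_def u_norm by blast
  have Imw: "Im w \<ge> 0" by (simp add: w_def u_def)
  have wfar: "dist w 1 \<ge> 2 * d" "dist w (-1) \<ge> 2 * d"
    using far[OF pathfinish_in_path_image] u_dist[of _ 1] u_dist[of _ "-1"] by (auto simp: w_def)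
  define e where "e = sgn w"
  have enorm: "cmod e = 1" using wpos by (simp add: e_def norm_sgn)
  have we: "w = of_real (cmod w) * e"
    by (simp add: e_def sgn_eq)
  have Ime: "Im e \<ge> 0" using Imw wpos by (simp add: e_def sgn_eq)
  have in_box: "x \<in> cbox (-1) (Complex 1 1)" if "cmod x \<le> 1" "Im x \<ge> 0" for x
    using that abs_Re_le_cmod[of x] abs_Im_le_cmod[of x] by (auto simp: in_cbox_complex_iff)
  define A B where "A = u (pathstart c)" and "B = u (pathfinish c)"
  define c' where "c' = linepath (-1) A +++ (u \<circ> c) +++ linepath B 1"
  define g' where "g' = (u \<circ> g) +++ linepath w e +++ linepath e (Complex (Re e) 1)"
  have A: "dist A (-1) < d" "cmod A < 1" and B: "dist B 1 < d" "cmod B < 1"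
    using c0 c1 u_dist[of _ 1] u_dist[of _ "-1"] c(2)
      pathstart_in_path_image[of c] pathfinish_in_path_image[of c]
    by (auto simp: A_def B_def u_norm)
  have uc: "path (u \<circ> c)" "pathstart (u \<circ> c) = A" "pathfinish (u \<circ> c) = B"
    and ug: "path (u \<circ> g)" "pathstart (u \<circ> g) = 0" "pathfinish (u \<circ> g) = w"
    using c g u_cont
    by (auto simp: A_def B_def w_def pathstart_compose pathfinish_compose u_def Complex_eq_0
        intro: path_continuous_image)
  have pc': "path c'" "pathstart c' = -1" "pathfinish c' = 1"
    by (auto simp: c'_def uc)
  have pg': "path g'" "pathstart g' = 0" "pathfinish g' = Complex (Re e) 1"
    by (auto simp: g'_def ug)
  have ic': "path_image c' = closed_segment (-1) A \<union> u ` path_image c \<union> closed_segment B 1"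
    by (simp add: c'_def path_image_join uc path_image_compose Un_assoc)
  have ig': "path_image g' = u ` path_image g \<union> closed_segment w e \<union> closed_segment e (Complex (Re e) 1)"
    by (simp add: g'_def path_image_join ug path_image_compose Un_assoc)
  have cvx: "convex {x. Im x \<ge> 0 \<and> cmod x \<le> 1}"
  proof -
    have "{x. Im x \<ge> 0 \<and> cmod x \<le> 1} = {x. Im x \<ge> 0} \<inter> cball 0 1" by auto
    then show ?thesis by (simp add: convex_Int convex_halfspace_Im_ge)
  qed
  have seg1: "closed_segment (-1) A \<subseteq> ball (-1) d \<inter> {x. Im x \<ge> 0 \<and> cmod x \<le> 1}"
    using A dpos by (intro closed_segment_subset convex_Int cvx) (auto simp: dist_commute A_def u_def)
  have seg2: "closed_segment B 1 \<subseteq> ball 1 d \<inter> {x. Im x \<ge> 0 \<and> cmod x \<le> 1}"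
    using B dpos by (intro closed_segment_subset convex_Int cvx) (auto simp: dist_commute B_def u_def)
  have seg3: "closed_segment w e \<subseteq> {x. Im x \<ge> 0 \<and> cmod x \<le> 1}"
    using enorm Ime Imw wlt by (intro closed_segment_subset cvx) auto
  \<comment> \<open>On the radial piece the modulus grows from that of \<open>w\<close> to 1. Hence
    the piece stays beyond \<open>c\<close>, and by \<open>close\<close> its length is below
    \<open>d\<close>.\<close>
  have seg3': "cmod x \<ge> cmod w \<and> dist x w < d" if x: "x \<in> closed_segment w e" for x
  proof -
    obtain t where t: "0 \<le> t" "t \<le> 1" "x = (1 - t) *\<^sub>R w + t *\<^sub>R e"
      using x by (auto simp: in_segment)
    have x': "x = of_real ((1 - t) * cmod w + t) * e"
      unfolding t(3) by (subst (1) we) (simp add: scaleR_conv_of_real algebra_simps)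
    have "cmod x = (1 - t) * cmod w + t"
      unfolding x' norm_mult enorm norm_of_real using t wpos by simp
    moreover have "x - w = of_real (t * (1 - cmod w)) * e"
      unfolding x' by (subst (2) we) (simp add: algebra_simps)
    then have "dist x w = t * (1 - cmod w)"
      by (simp only: dist_norm norm_mult enorm norm_of_real) (use t wlt in simp)
    moreover have "t * (1 - cmod w) \<le> 1 - cmod w" "t * (1 - cmod w) \<ge> 0"
      using t wlt by (auto simp: mult_left_le_one_le)
    ultimately show ?thesis
      using close by (auto simp: w_def u_norm algebra_simps)
  qed
  have seg4: "Re x = Re e \<and> Im e \<le> Im x \<and> Im x \<le> 1"
    if x: "x \<in> closed_segment e (Complex (Re e) 1)" for x
  proof -
    obtain t where t: "0 \<le> t" "t \<le> 1" "x = (1 - t) *\<^sub>R e + t *\<^sub>R Complex (Re e) 1"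
      using x by (auto simp: in_segment)
    have "Im e \<le> 1" using abs_Im_le_cmod[of e] enorm by auto
    then have "t * Im e \<le> t" "(1 - t) * Im e \<le> 1 - t" using t by (auto intro: mult_left_le)
    moreover have "Re x = Re e" "Im x = (1 - t) * Im e + t"
      unfolding t(3) by (simp_all add: algebra_simps)
    ultimately show ?thesis by (auto simp: algebra_simps)
  qed
  \<comment> \<open>As \<open>Im e\<close> is nonnegative, moving upwards from \<open>e\<close>
    increases the modulus, so the vertical piece leaves the closed disc at once.\<close>
  have seg4': "cmod x > 1 \<or> x = e" if "x \<in> closed_segment e (Complex (Re e) 1)" for x
  proof (cases "Im x = Im e")
    case True
    then show ?thesis using seg4[OF that] by (simp add: complex_eq_iff)
  next
    case False
    then have "(Im e)\<^sup>2 < (Im x)\<^sup>2" using seg4[OF that] Ime by (intro power_strict_mono) auto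
    then have "(cmod x)\<^sup>2 > (cmod e)\<^sup>2" using seg4[OF that] by (simp add: cmod_power2)
    then have "cmod e < cmod x" by (rule power2_less_imp_less) simp
    then show ?thesis by (simp add: enorm)
  qed
  have u_box: "u ` S \<subseteq> cbox (-1) (Complex 1 1)" if S: "S \<subseteq> ball 0 1" for S
  proof
    fix x assume "x \<in> u ` S"
    then obtain y where "x = u y" "cmod y < 1" using S by auto
    then show "x \<in> cbox (-1) (Complex 1 1)"
      using u_norm[of y] by (intro in_box) (auto simp: u_def)
  qed
  have "path_image c' \<subseteq> cbox (-1) (Complex 1 1)"
    using seg1 seg2 u_box[OF c(2)] in_box unfolding ic' by blast
  moreover have "path_image g' \<subseteq> cbox (-1) (Complex 1 1)"
  proof -
    have "closed_segment e (Complex (Re e) 1) \<subseteq> cbox (-1) (Complex 1 1)"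
    proof
      fix x assume "x \<in> closed_segment e (Complex (Re e) 1)"
      from seg4[OF this] show "x \<in> cbox (-1) (Complex 1 1)"
        using abs_Re_le_cmod[of e] enorm Ime by (auto simp: in_cbox_complex_iff)
    qed
    then show ?thesis
      using seg3 u_box[OF g(2)] in_box unfolding ig' by blast
  qed
  ultimately obtain x where x: "x \<in> path_image c'" "x \<in> path_image g'"
    using pc' pg' fashoda_complex[of c' g' "-1" "Complex 1 1"] by auto
  have far': "dist x 1 \<ge> 2 * d \<and> dist x (-1) \<ge> 2 * d" if "x \<in> u ` path_image g" for x
    using that far u_dist[of _ 1] u_dist[of _ "-1"] by auto
  \<comment> \<open>This is where the margin \<open>2 * d\<close> is spent: the folded
    \<open>g\<close> and the point \<open>w\<close> keep distance \<open>2 * d\<close> from both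
    ends, and the radial piece strays less than \<open>d\<close> from \<open>w\<close>.\<close>
  have near_false: False if "dist x a < d" "cmod x \<le> 1" "a = 1 \<or> a = -1" for a
  proof -
    have "x \<notin> u ` path_image g" using far'[of x] that dpos by force
    then have "x \<in> closed_segment w e"
      using x(2) seg4'[of x] that(2) unfolding ig' by auto
    then have "dist x w < d" using seg3' by blast
    then show False using wfar that dist_triangle[of w a x] by (auto simp: dist_commute)
  qed
  have "x \<notin> closed_segment (-1) A" "x \<notin> closed_segment B 1"
    using near_false[of "-1"] near_false[of 1] seg1 seg2 by (auto simp: dist_commute subset_iff)
  then have xc: "x \<in> u ` path_image c" using x(1) ic' by auto
  then have xlt: "cmod x < cmod w" using outer by (auto simp: w_def u_norm)
  have "x \<notin> closed_segment w e" using seg3'[of x] xlt by auto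
  moreover have "x \<notin> closed_segment e (Complex (Re e) 1)"
    using seg4'[of x] xlt wlt enorm by auto
  ultimately have "x \<in> u ` path_image g" using x(2) ig' by auto
  with xc show ?thesis using that u_eq by blast
qed

text \<open>Argue by contradiction with the superlevel set of \<open>cmod (G z)\<close> above
  \<open>m\<close>. By the maximum principle its component of \<open>0\<close> comes near the
  circle, so it contains a path that meets \<open>c\<close> or the mirror image of \<open>c\<close>,
  where the modulus of \<open>G\<close> is at most \<open>e\<close>. The entry \<open>2 * d\<close>
  in the bound keeps that path away from \<open>-1\<close> and \<open>1\<close>, and the factor 2
  comes from \<open>(1 - z\<^sup>2) / 2\<close> being \<open>1/2\<close> at
  \<open>0\<close>.\<close>

lemma two_constants_diameter:
  assumes holf: "f holomorphic_on ball 0 1"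
    and f1: "\<And>z. cmod z < 1 \<Longrightarrow> cmod (f z) \<le> 1"
    and c: "path c" "path_image c \<subseteq> ball 0 1"
    and c0: "dist (pathstart c) (-1) < d" and c1: "dist (pathfinish c) 1 < d"
    and fc: "\<And>x. x \<in> path_image c \<Longrightarrow> cmod (f x) \<le> e"
  shows "(cmod (f 0))\<^sup>2 \<le> 2 * max e (2 * d)"
proof (rule ccontr)
  define m where "m = max e (2 * d)"
  assume "\<not> ?thesis"
  then have m: "m < (cmod (f 0))\<^sup>2 / 2" by (simp add: m_def)
  have dpos: "d > 0" using c0 by (meson le_less_trans zero_le_dist)
  \<comment> \<open>The modulus of \<open>G\<close> is symmetric about the real axis, and the last factor makes \<open>G\<close> small near
    \<open>-1\<close> and \<open>1\<close>, which closes the gaps left by the ends of \<open>c\<close>.\<close>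
  define G where "G z = f z * (cnj \<circ> f \<circ> cnj) z * ((1 - z\<^sup>2) / 2)" for z
  have cnj_ball: "cnj ` ball 0 1 = ball 0 1"
    by (auto simp: image_cnj_conv_vimage_cnj)
  have holG: "G holomorphic_on ball 0 1"
    unfolding G_def
    by (intro holomorphic_intros holf holomorphic_on_compose_cnj_cnj) (auto simp: cnj_ball holf)
  have nG: "cmod (G z) = cmod (f z) * cmod (f (cnj z)) * (cmod (1 - z\<^sup>2) / 2)" for z
    by (simp add: G_def norm_mult norm_divide)
  have G_cnj: "cmod (G (cnj z)) = cmod (G z)" for z
  proof -
    have "cmod (1 - (cnj z)\<^sup>2) = cmod (1 - z\<^sup>2)"
      by (metis complex_cnj_diff complex_cnj_one complex_cnj_power complex_mod_cnj)
    then show ?thesis by (simp add: nG mult_ac)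
  qed
  have ff: "cmod (f z) * cmod (f (cnj z)) \<le> 1" if "cmod z < 1" for z
    using that f1[of z] f1[of "cnj z"] by (intro mult_le_one) auto
  have fac: "cmod (1 - z\<^sup>2) = dist z 1 * dist z (-1)" for z
  proof -
    have "1 - z\<^sup>2 = - ((z - 1) * (z - (-1)))" by (simp add: power2_eq_square algebra_simps)
    then show ?thesis by (simp only: dist_norm norm_minus_cancel norm_mult)
  qed
  have two: "dist z 1 \<le> 2" "dist z (-1) \<le> 2" if "cmod z < 1" for z
    using that dist_triangle[of z 1 0] dist_triangle[of z "-1" 0] by auto
  have G_near: "cmod (G z) \<le> dist z 1" "cmod (G z) \<le> dist z (-1)" if "cmod z < 1" for z
  proof -
    have "cmod (G z) \<le> cmod (1 - z\<^sup>2) / 2"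
      using ff[OF that] unfolding nG by (intro mult_left_le_one_le) auto
    moreover have "dist z 1 * dist z (-1) \<le> dist z 1 * 2" "dist z 1 * dist z (-1) \<le> 2 * dist z (-1)"
      using two[OF that] by (auto intro: mult_left_mono mult_right_mono)
    ultimately show "cmod (G z) \<le> dist z 1" "cmod (G z) \<le> dist z (-1)"
      unfolding fac by linarith+
  qed
  have G_le_f: "cmod (G z) \<le> cmod (f z)" if "cmod z < 1" for z
  proof -
    have "cmod (1 - z\<^sup>2) \<le> 1 + (cmod z)\<^sup>2"
      by (metis norm_triangle_ineq4 norm_one norm_power)
    also have "\<dots> \<le> 2" using that by (simp add: power_le_one)
    finally have "cmod (f (cnj z)) * (cmod (1 - z\<^sup>2) / 2) \<le> 1"
      using f1[of "cnj z"] that by (intro mult_le_one) auto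
    then show ?thesis
      unfolding nG mult.assoc by (rule mult_left_le) simp
  qed
  define S where "S = {z \<in> ball 0 1. cmod (G z) > m}"
  have "S = ball 0 1 \<inter> (\<lambda>z. cmod (G z)) -` {m<..}" by (auto simp: S_def)
  then have opS: "open S"
    using holomorphic_on_imp_continuous_on[OF holG]
    by (auto intro!: continuous_open_preimage continuous_intros)
  define U where "U = connected_component_set S 0"
  have opU: "open U" unfolding U_def by (rule open_connected_component[OF opS])
  have US: "U \<subseteq> S" unfolding U_def by (rule connected_component_subset)
  have "0 \<in> S" using m by (simp add: S_def nG power2_eq_square)
  then have U0: "0 \<in> U" by (simp add: U_def)
  obtain r0 where r0: "r0 < 1" "\<And>x. x \<in> path_image c \<Longrightarrow> cmod x \<le> r0"
  proof -
    obtain x where "x \<in> path_image c" "\<And>y. y \<in> path_image c \<Longrightarrow> cmod y \<le> cmod x"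
      using continuous_attains_sup[of "path_image c" cmod] compact_path_image[OF c(1)]
      by (auto intro: continuous_intros)
    then show ?thesis using that[of "cmod x"] c(2) by auto
  qed
  \<comment> \<open>A point of modulus above \<open>r\<close> lies both beyond every point of
    \<open>c\<close> and within \<open>d\<close> of the circle, as the crossing lemma demands of the
    end of \<open>g\<close>.\<close>
  define r where "r = max r0 (1 - d)"
  have r1: "r < 1" using r0(1) dpos by (simp add: r_def)
  \<comment> \<open>Otherwise the closure of \<open>U\<close> stays in the open disc, its frontier
    avoids \<open>S\<close>, and the maximum principle gives \<open>cmod (G 0) \<le> m\<close>,
    although \<open>0\<close> lies in \<open>S\<close>.\<close>
  have "\<exists>w\<in>U. cmod w > r"
  proof (rule ccontr)
    assume "\<not> ?thesis"
    then have Ur: "U \<subseteq> cball 0 r" by force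
    then have clU: "closure U \<subseteq> cball 0 r" by (simp add: closure_minimal)
    also have "cball 0 r \<subseteq> ball (0::complex) 1" using r1 by auto
    finally have clU1: "closure U \<subseteq> ball 0 1" .
    have "cmod (G z) \<le> m" if z: "z \<in> frontier U" for z
    proof -
      have "z \<in> frontier S"
        using frontier_of_connected_component_subset z U_def by blast
      then have "z \<notin> S" using opS by (simp add: frontier_def interior_open)
      moreover have "z \<in> ball 0 1" using z clU1 by (auto simp: frontier_def)
      ultimately show ?thesis by (auto simp: S_def)
    qed
    moreover have "G holomorphic_on interior U"
      using holG clU1 closure_subset interior_subset by (meson holomorphic_on_subset order_trans)
    moreover have "continuous_on (closure U) G"
      using holomorphic_on_imp_continuous_on[OF holG] clU1 continuous_on_subset by blast
    moreover have "bounded U" using Ur bounded_cball bounded_subset by blast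
    ultimately have "cmod (G 0) \<le> m" using maximum_modulus_frontier U0 by blast
    then show False using \<open>0 \<in> S\<close> by (simp add: S_def)
  qed
  then obtain w where w: "w \<in> U" "cmod w > r" by blast
  have "path_connected U"
    using opU by (simp add: U_def connected_open_path_connected)
  then obtain g where g: "path g" "path_image g \<subseteq> U" "pathstart g = 0" "pathfinish g = w"
    using U0 w unfolding path_connected_def by blast
  have gS: "cmod y < 1 \<and> cmod (G y) > m" if "y \<in> path_image g" for y
    using that g(2) US by (auto simp: S_def)
  \<comment> \<open>On \<open>g\<close> the modulus of \<open>G\<close> exceeds \<open>m\<close>,
    which is at least \<open>2 * d\<close>, whereas \<open>G_near\<close> bounds it by the distance
    to either end.\<close>
  have far: "dist y 1 \<ge> 2 * d \<and> dist y (-1) \<ge> 2 * d" if "y \<in> path_image g" for y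
    using gS[OF that] G_near[of y] by (auto simp: m_def)
  obtain x y where xy: "x \<in> path_image c" "y \<in> path_image g" "x = y \<or> x = cnj y"
  proof (rule crossing_paths_in_disc[OF c c0 c1 g(1) _ g(3)])
    show "path_image g \<subseteq> ball 0 1" using gS by auto
    show "cmod x < cmod (pathfinish g)" if "x \<in> path_image c" for x
      using r0(2)[OF that] w(2) g(4) by (auto simp: r_def)
    show "1 - d < cmod (pathfinish g)" using w(2) g(4) by (auto simp: r_def)
  qed (use far in auto)
  then have "cmod (G x) > m" using gS[OF xy(2)] G_cnj by auto
  moreover have "cmod (G x) \<le> e" using G_le_f[of x] fc[OF xy(1)] xy(1) c(2) by force
  ultimately show False by (simp add: m_def)
qed

subsection \<open>The theorems of Koebe and Lindelof\<close>

text \<open>A sequence of Koebe arcs with the index replaced by a tolerance: the same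
  \<open>e\<close> governs both endpoints and the size of \<open>f\<close>.\<close>

definition vanishes_along_arcs :: "(complex \<Rightarrow> complex) \<Rightarrow> complex \<Rightarrow> complex \<Rightarrow> bool" where
  "vanishes_along_arcs f a b \<longleftrightarrow>
     (\<forall>e>0. \<exists>c. path c \<and> path_image c \<subseteq> ball 0 1 \<and> dist (pathstart c) a < e \<and>
        dist (pathfinish c) b < e \<and> (\<forall>x\<in>path_image c. cmod (f x) < e))"

text \<open>Uniform continuity of \<open>S\<close> on the closed disc carries the endpoint
  conditions over to \<open>S \<circ> c\<close>, and since \<open>M\<close> undoes \<open>S\<close>,
  the map \<open>f \<circ> M\<close> takes on \<open>S \<circ> c\<close> the values that
  \<open>f\<close> takes on \<open>c\<close>.\<close>

lemma vanishes_along_arcs_transport: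
  assumes arcs: "vanishes_along_arcs f a b"
    and S: "continuous_on (cball 0 1) S" "S ` ball 0 1 \<subseteq> ball 0 1"
    and MS: "\<And>z. z \<in> ball 0 1 \<Longrightarrow> M (S z) = z"
    and ab: "a \<in> cball 0 1" "b \<in> cball 0 1"
  shows "vanishes_along_arcs (f \<circ> M) (S a) (S b)"
  unfolding vanishes_along_arcs_def
proof (intro allI impI)
  fix e :: real assume "e > 0"
  obtain d where d: "d > 0" "\<And>x y. x \<in> cball 0 1 \<Longrightarrow> y \<in> cball 0 1 \<Longrightarrow> dist x y < d \<Longrightarrow> dist (S x) (S y) < e"
    using compact_uniformly_continuous[OF S(1) compact_cball] \<open>e > 0\<close>
    unfolding uniformly_continuous_on_def by metis
  have "min d e > 0" using \<open>e > 0\<close> d(1) by simp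
  then obtain c where c: "path c" "path_image c \<subseteq> ball 0 1" "dist (pathstart c) a < min d e"
      "dist (pathfinish c) b < min d e" "\<And>x. x \<in> path_image c \<Longrightarrow> cmod (f x) < min d e"
    using arcs unfolding vanishes_along_arcs_def by meson
  have cin: "c t \<in> ball 0 1" if "t \<in> {0..1}" for t
    using that c(2) unfolding path_image_def by blast
  have "path_image (S \<circ> c) \<subseteq> ball 0 1"
    using c(2) S(2) unfolding path_image_compose by blast
  moreover have "path (S \<circ> c)"
    using c by (intro path_continuous_image continuous_on_subset[OF S(1)]) auto
  moreover have "dist (pathstart (S \<circ> c)) (S a) < e" "dist (pathfinish (S \<circ> c)) (S b) < e"
    unfolding pathstart_compose pathfinish_compose
    using c(3,4) cin[of 0] cin[of 1] ab
    by (auto intro!: d(2) simp: pathstart_def pathfinish_def less_imp_le)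
  moreover have "\<forall>x\<in>path_image (S \<circ> c). cmod ((f \<circ> M) x) < e"
    using c(2,5) MS by (auto simp: path_image_compose subset_iff)
  ultimately show "\<exists>c. path c \<and> path_image c \<subseteq> ball 0 1 \<and> dist (pathstart c) (S a) < e \<and>
        dist (pathfinish c) (S b) < e \<and> (\<forall>x\<in>path_image c. cmod ((f \<circ> M) x) < e)"
    by blast
qed

text \<open>The pole of the map lies outside the closed disc. Continuity up to the circle is what
  allows boundary points to be transported.\<close>

lemma Moebius_function_continuous_on_cball:
  assumes "cmod w < 1"
  shows "continuous_on (cball 0 1) (Moebius_function t w)"
proof -
  have "1 - cnj w * z \<noteq> 0" if "z \<in> cball 0 1" for z
  proof
    assume "1 - cnj w * z = 0"
    then have "cmod (cnj w * z) = 1" by (metis eq_iff_diff_eq_0 norm_one)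
    moreover have "cmod w * cmod z \<le> cmod w" using that by (simp add: mult_left_le)
    ultimately show False using assms by (simp add: norm_mult)
  qed
  then show ?thesis
    unfolding Moebius_function_def by (intro continuous_intros) auto
qed

lemma vanishes_along_arcs_diameter_imp_zero_at_0:
  assumes "f holomorphic_on ball 0 1" "\<And>z. cmod z < 1 \<Longrightarrow> cmod (f z) \<le> 1"
    and "vanishes_along_arcs f (-1) 1"
  shows "f 0 = 0"
proof (rule ccontr)
  assume "f 0 \<noteq> 0"
  \<comment> \<open>With \<open>d = e\<close> the estimate reads \<open>8 * e \<le> 4 * e\<close>,
    which is absurd for positive \<open>e\<close>.\<close>
  define e where "e = (cmod (f 0))\<^sup>2 / 8"
  have "e > 0" using \<open>f 0 \<noteq> 0\<close> by (simp add: e_def)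
  then obtain c where c: "path c" "path_image c \<subseteq> ball 0 1" "dist (pathstart c) (-1) < e"
      "dist (pathfinish c) 1 < e" "\<And>x. x \<in> path_image c \<Longrightarrow> cmod (f x) < e"
    using assms(3) unfolding vanishes_along_arcs_def by meson
  have "(cmod (f 0))\<^sup>2 \<le> 2 * max e (2 * e)"
    by (rule two_constants_diameter[OF assms(1,2) c(1-4)]) (auto intro: less_imp_le c(5))
  then show False using \<open>e > 0\<close> by (simp add: e_def)
qed

text \<open>Moebius maps with real parameter fix \<open>-1\<close> and \<open>1\<close>, so the
  result at the centre, applied to \<open>f\<close> after such a map, gives zeros at all points of
  the real diameter. The identity theorem does the rest.\<close>

lemma vanishes_along_arcs_diameter_imp_zero:
  assumes holf: "f holomorphic_on ball 0 1" and f1: "\<And>z. cmod z < 1 \<Longrightarrow> cmod (f z) \<le> 1"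
    and arcs: "vanishes_along_arcs f (-1) 1" and z: "z \<in> ball 0 1"
  shows "f z = 0"
proof -
  have real0: "f (of_real x) = 0" if "\<bar>x\<bar> < 1" for x
  proof -
    let ?S = "Moebius_function 0 (of_real x)" and ?M = "Moebius_function 0 (- of_real x)"
    have x: "cmod (of_real x) < 1" "cmod (- of_real x) < 1" using that by auto
    have "?S (-1) = -1" "?S 1 = 1"
      using that by (auto simp: Moebius_function_simple divide_simps complex_eq_iff)
    moreover have "vanishes_along_arcs (f \<circ> ?M) (?S (-1)) (?S 1)"
    proof (rule vanishes_along_arcs_transport[OF arcs Moebius_function_continuous_on_cball[OF x(1)]])
      show "?S ` ball 0 1 \<subseteq> ball 0 1"
        using Moebius_function_norm_lt_1[OF x(1)] by auto
    qed (use x in \<open>auto simp: Moebius_function_compose\<close>)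
    ultimately have "vanishes_along_arcs (f \<circ> ?M) (-1) 1" by simp
    moreover have "f \<circ> ?M holomorphic_on ball 0 1"
      by (rule holomorphic_on_compose_gen[OF Moebius_function_holomorphic[OF x(2)] holf])
        (use x Moebius_function_norm_lt_1 in auto)
    moreover have "cmod ((f \<circ> ?M) z) \<le> 1" if "cmod z < 1" for z
      using f1 that x(2) Moebius_function_norm_lt_1 by simp
    ultimately have "(f \<circ> ?M) 0 = 0" by (rule vanishes_along_arcs_diameter_imp_zero_at_0[rotated 2])
    then show ?thesis by (simp add: Moebius_function_of_zero)
  qed
  show ?thesis
  proof (rule analytic_continuation[OF holf, of "of_real ` {-1<..<1}" 0])
    show "0 islimpt complex_of_real ` {-1<..<1}"
      unfolding islimpt_approachable
    proof (intro allI impI)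
      fix e :: real assume "e > 0"
      then show "\<exists>y\<in>complex_of_real ` {-1<..<1}. y \<noteq> 0 \<and> dist y 0 < e"
        by (intro bexI[of _ "of_real (min (1/2) (e/2))"]) (auto simp: min_def)
    qed
  qed (use real0 z in auto)
qed

theorem Koebe_arcs:
  assumes holf: "f holomorphic_on ball 0 1" and f1: "\<And>z. cmod z < 1 \<Longrightarrow> cmod (f z) \<le> 1"
    and ab: "cmod a = 1" "cmod b = 1" "a \<noteq> b"
    and arcs: "vanishes_along_arcs f a b" and z: "z \<in> ball 0 1"
  shows "f z = 0"
proof -
  \<comment> \<open>The rotation by \<open>v\<close> places \<open>a\<close> and \<open>b\<close> symmetrically about the imaginary axis; a Moebius map
    with purely imaginary parameter \<open>w\<close> then moves them to \<open>-1\<close> and \<open>1\<close>.\<close>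
  obtain v where v: "v\<^sup>2 * (a * b) = -1" "Re (v * b) \<ge> 0"
  proof -
    \<comment> \<open>On the unit circle the equation \<open>v\<^sup>2 * (a * b) = -1\<close> says
      that \<open>v * a\<close> is the mirror image of \<open>v * b\<close> in the imaginary axis.
      It survives the change from \<open>v\<close> to \<open>-v\<close>, which leaves the sign of
      \<open>Re (v * b)\<close> free to choose.\<close>
    define v where "v = csqrt (- cnj (a * b))"
    have "v\<^sup>2 * (a * b) = - ((a * b) * cnj (a * b))" by (simp add: v_def mult_ac)
    also have "\<dots> = -1" by (simp only: complex_norm_square[symmetric]) (simp add: norm_mult ab)
    finally have v2: "v\<^sup>2 * (a * b) = -1" .
    show ?thesis
    proof (cases "Re (v * b) \<ge> 0")
      case True
      then show ?thesis using that v2 by blast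
    next
      case False
      then show ?thesis using that[of "-v"] v2 by simp
    qed
  qed
  have v1: "cmod v = 1"
  proof -
    have "(cmod v)\<^sup>2 = cmod (v\<^sup>2 * (a * b))" by (simp add: norm_mult norm_power ab)
    then have "(cmod v)\<^sup>2 = 1" using v(1) by simp
    then show ?thesis by (simp add: power2_eq_1_iff) (smt (verit) norm_ge_zero)
  qed
  define u where "u = v * b"
  have u: "cmod u = 1" "Re u \<ge> 0" "u \<noteq> 0" using v v1 ab by (auto simp: u_def norm_mult)
  have uu: "u * cnj u = 1" using u(1) by (simp add: complex_norm_square[symmetric])
  have uva: "u * (v * a) = -1" using v(1) by (simp add: u_def power2_eq_square mult_ac)
  have va: "v * a = - cnj u"
    using uu uva u(3) by (metis mult_left_cancel mult_minus_right)
  have "Re u \<noteq> 0"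
  proof
    assume "Re u = 0"
    then have "v * a = v * b" unfolding va by (simp add: u_def[symmetric] complex_eq_iff)
    then show False using ab v1 by auto
  qed
  then have Reu: "Re u > 0" using u by simp
  have up1: "u + 1 \<noteq> 0" using Reu by (auto simp: complex_eq_iff)
  \<comment> \<open>The solution of \<open>(u - w) / (1 + w * u) = 1\<close>. Since
    \<open>cnj w = - w\<close> will hold, this says that the Moebius map with parameter
    \<open>w\<close> sends \<open>u\<close> to 1. Positivity of \<open>Re u\<close> places
    \<open>w\<close> in the disc.\<close>
  define w where "w = (u - 1) / (u + 1)"
  have w1: "cmod w < 1"
  proof -
    have "(cmod (u - 1))\<^sup>2 < (cmod (u + 1))\<^sup>2"
      using Reu unfolding cmod_power2 by (simp add: power2_eq_square algebra_simps)
    then have "cmod (u - 1) < cmod (u + 1)" by (rule power2_less_imp_less) simp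
    then show ?thesis using up1 by (simp add: w_def norm_divide)
  qed
  have cu: "cnj u = 1 / u" using uu u(3) by (simp add: field_simps)
  have cw: "cnj w = - w"
  proof -
    have "cnj w = ((1 - u) / u) / ((1 + u) / u)"
      using u(3) by (simp add: w_def cu diff_divide_distrib add_divide_distrib add.commute)
    also have "\<dots> = - w"
      using u(3) by (simp add: w_def add.commute minus_divide_left)
    finally show ?thesis .
  qed
  \<comment> \<open>This is the common numerator of \<open>u - w\<close> and
    \<open>1 + w * u\<close>, to be cancelled in \<open>Sb\<close>. By \<open>uu\<close> it equals
    \<open>u * (u + cnj u)\<close>.\<close>
  have u21: "u\<^sup>2 + 1 \<noteq> 0"
  proof
    assume "u\<^sup>2 + 1 = 0"
    then have "u * (u + cnj u) = 0" using uu by (simp add: algebra_simps power2_eq_square)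
    then show False using Reu by (auto simp: complex_eq_iff)
  qed
  define S where "S z = Moebius_function 0 w (v * z)" for z
  define M where "M z = cnj v * Moebius_function 0 (- w) z" for z
  have vv: "cnj v * v = 1" using v1 by (simp add: complex_norm_square[symmetric] mult.commute)
  have Sb: "S b = 1"
  proof -
    have "u - w = (u\<^sup>2 + 1) / (u + 1)" "1 + w * u = (u\<^sup>2 + 1) / (u + 1)"
      using up1 by (simp_all add: w_def field_simps power2_eq_square)
    then show ?thesis
      using u21 up1 by (simp add: S_def Moebius_function_simple cw u_def[symmetric])
  qed
  have Sa: "S a = -1"
  proof -
    \<comment> \<open>Dividing this equation by \<open>u\<close> and using
      \<open>u * cnj u = 1\<close> turns it into the condition that \<open>- cnj u\<close> is sent
      to \<open>-1\<close>.\<close>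
    have "w * (u + 1) = u - 1" using up1 by (simp add: w_def)
    then have "u * (1 - cnj u) = u * (w * (cnj u + 1))"
      using uu by algebra
    then have "1 - cnj u = w * (cnj u + 1)"
      using u(3) mult_left_cancel by blast
    then have "- cnj u - w = - (1 - w * cnj u)"
      by (simp add: algebra_simps)
    moreover have "cmod (w * cnj u) \<noteq> cmod 1" using w1 u(1) by (simp add: norm_mult)
    then have "1 - w * cnj u \<noteq> 0" by auto
    ultimately have "(- cnj u - w) / (1 - w * cnj u) = - 1"
      by (metis divide_self minus_divide_left)
    then show ?thesis
      by (simp add: S_def Moebius_function_simple cw va)
  qed
  have Sball: "S z \<in> ball 0 1" if "z \<in> ball 0 1" for z
    using that w1 v1 by (auto simp: S_def norm_mult intro!: Moebius_function_norm_lt_1)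
  have Mball: "M z \<in> ball 0 1" if "z \<in> ball 0 1" for z
    using that w1 v1 by (auto simp: M_def norm_mult intro!: Moebius_function_norm_lt_1)
  have MS: "M (S z) = z" if "z \<in> ball 0 1" for z
    using that w1 v1 vv by (simp add: S_def M_def Moebius_function_compose norm_mult mult.assoc[symmetric])
  have "vanishes_along_arcs (f \<circ> M) (S a) (S b)"
  proof (rule vanishes_along_arcs_transport[OF arcs, where S = S and M = M])
    show "continuous_on (cball 0 1) S"
      unfolding S_def
      by (rule continuous_on_compose2[OF Moebius_function_continuous_on_cball[OF w1]])
        (auto intro!: continuous_intros simp: norm_mult v1)
  qed (use Sball ab MS in auto)
  then have "vanishes_along_arcs (f \<circ> M) (-1) 1" by (simp add: Sa Sb)
  moreover have "f \<circ> M holomorphic_on ball 0 1"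
  proof (rule holomorphic_on_compose_gen[OF _ holf])
    show "M holomorphic_on ball 0 1"
      unfolding M_def using w1 by (intro holomorphic_intros Moebius_function_holomorphic) auto
  qed (use Mball in auto)
  moreover have "cmod ((f \<circ> M) z) \<le> 1" if "cmod z < 1" for z
    using f1 Mball[of z] that by simp
  ultimately have "(f \<circ> M) (S z) = 0"
    using vanishes_along_arcs_diameter_imp_zero[of "f \<circ> M"] Sball[OF z] by blast
  then show ?thesis using MS[OF z] by simp
qed

text \<open>Fix a point \<open>\<eta> s1\<close> so far along the curve that \<open>f\<close> is
  small from there on. For \<open>r\<close> near 1, the disc automorphism \<open>S\<close> that
  takes \<open>of_real r * \<alpha>\<close> to \<open>0\<close> and \<open>\<alpha>\<close> to 1
  sends \<open>\<eta> s1\<close> close to \<open>-1\<close> and the tail of the curve towards 1. The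
  estimate at the centre then bounds \<open>f (of_real r * \<alpha>)\<close>.\<close>

theorem Lindelof_radial_limit:
  fixes \<eta> :: "real \<Rightarrow> complex"
  assumes holf: "f holomorphic_on ball 0 1" and f1: "\<And>z. cmod z < 1 \<Longrightarrow> cmod (f z) \<le> 1"
    and \<eta>: "continuous_on {0<..<1} \<eta>" "\<eta> ` {0<..<1} \<subseteq> ball 0 1"
    and lim: "(\<eta> \<longlongrightarrow> \<alpha>) (at_right 0)" "((\<lambda>s. f (\<eta> s)) \<longlongrightarrow> 0) (at_right 0)"
    and \<alpha>: "cmod \<alpha> = 1"
  shows "((\<lambda>r::real. f (of_real r * \<alpha>)) \<longlongrightarrow> 0) (at_left 1)"
proof (rule tendstoI)
  fix e :: real assume e: "e > 0"
  \<comment> \<open>The estimate will give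
    \<open>(cmod (f (of_real r * \<alpha>)))\<^sup>2 \<le> 4 * d\<close>, and \<open>4 * d\<close>
    is half of \<open>e\<^sup>2\<close>.\<close>
  define d where "d = e\<^sup>2 / 8"
  have d: "d > 0" using e by (simp add: d_def)
  have "eventually (\<lambda>s. dist (f (\<eta> s)) 0 < d) (at_right 0)"
    using lim(2) d by (rule tendstoD)
  then have "\<exists>b>0. \<forall>s>0. s < b \<longrightarrow> dist (f (\<eta> s)) 0 < d"
    unfolding eventually_at_right_field .
  then obtain s' where s': "s' > 0" "\<And>s. 0 < s \<Longrightarrow> s < s' \<Longrightarrow> cmod (f (\<eta> s)) < d"
    by auto
  define s1 where "s1 = min (s' / 2) (1 / 2)"
  have s1: "0 < s1" "s1 < s'" "s1 < 1" using s' by (auto simp: s1_def)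
  define A where "A = cnj \<alpha> * \<eta> s1"
  have aa: "cnj \<alpha> * \<alpha> = 1" using \<alpha> by (simp add: complex_norm_square[symmetric] mult.commute)
  have \<eta>b: "cmod (\<eta> s) < 1" if "0 < s" "s < 1" for s
    using \<eta>(2) that by force
  have A1: "cmod A < 1" using \<eta>b[OF s1(1,3)] \<alpha> by (simp add: A_def norm_mult)
  then have "A \<noteq> 1" by auto
  \<comment> \<open>The fixed point \<open>A\<close> is the rotated \<open>\<eta> s1\<close>; as
    \<open>r\<close> tends to 1 its Moebius image tends to \<open>-1\<close>. For this
    \<open>s1\<close> must be chosen before \<open>r\<close>.\<close>
  have "((\<lambda>r::real. (A - of_real r) / (1 - of_real r * A)) \<longlongrightarrow> (A - of_real 1) / (1 - of_real 1 * A)) (at_left 1)"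
    using \<open>A \<noteq> 1\<close> by (intro tendsto_intros) auto
  moreover have "(A - of_real 1) / (1 - of_real 1 * A) = -1"
    using \<open>A \<noteq> 1\<close> by (simp add: divide_simps)
  ultimately have "eventually (\<lambda>r::real. dist ((A - of_real r) / (1 - of_real r * A)) (-1) < d) (at_left 1)"
    using d tendstoD by metis
  moreover have "eventually (\<lambda>r::real. r \<in> {0<..<1}) (at_left 1)"
    by (rule eventually_at_left_real) simp
  ultimately show "eventually (\<lambda>r::real. dist (f (of_real r * \<alpha>)) 0 < e) (at_left 1)"
  proof eventually_elim
    case (elim r)
    let ?w = "complex_of_real r"
    have w1: "cmod ?w < 1" using elim by auto
    define S where "S z = Moebius_function 0 ?w (cnj \<alpha> * z)" for z
    define M where "M z = \<alpha> * Moebius_function 0 (- ?w) z" for z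
    have Sball: "S z \<in> ball 0 1" if "z \<in> ball 0 1" for z
      using that w1 \<alpha> by (auto simp: S_def norm_mult intro!: Moebius_function_norm_lt_1)
    have Mball: "M z \<in> ball 0 1" if "z \<in> ball 0 1" for z
      using that w1 \<alpha> by (auto simp: M_def norm_mult intro!: Moebius_function_norm_lt_1)
    have MS: "M (S z) = z" if "z \<in> ball 0 1" for z
      using that w1 \<alpha> aa
      by (simp add: S_def M_def Moebius_function_compose norm_mult mult.assoc[symmetric] mult.commute[of \<alpha>])
    have Scont: "continuous_on (cball 0 1) S"
      unfolding S_def
      by (rule continuous_on_compose2[OF Moebius_function_continuous_on_cball[OF w1]])
        (auto intro!: continuous_intros simp: norm_mult \<alpha>)
    have S\<alpha>: "S \<alpha> = 1"
      using elim by (auto simp: S_def aa Moebius_function_simple complex_eq_iff)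
    \<comment> \<open>Here \<open>r\<close> is already fixed, so the second parameter
      \<open>s2\<close> may depend on it.\<close>
    have "((\<lambda>s. S (\<eta> s)) \<longlongrightarrow> S \<alpha>) (at_right 0)"
    proof (rule continuous_on_tendsto_compose[OF Scont lim(1)])
      show "eventually (\<lambda>s. \<eta> s \<in> cball 0 1) (at_right 0)"
        using eventually_at_right_real[of 0 1] \<eta>b by (auto elim!: eventually_mono intro: less_imp_le)
    qed (use \<alpha> in auto)
    then have "eventually (\<lambda>s. dist (S (\<eta> s)) 1 < d) (at_right 0)"
      unfolding S\<alpha> using d by (rule tendstoD)
    moreover have "eventually (\<lambda>s. s \<in> {0<..<s1}) (at_right 0)"
      by (rule eventually_at_right_real) (use s1 in simp)
    ultimately have "eventually (\<lambda>s. dist (S (\<eta> s)) 1 < d \<and> s \<in> {0<..<s1}) (at_right 0)"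
      by eventually_elim auto
    then obtain s2 where s2: "dist (S (\<eta> s2)) 1 < d" "0 < s2" "s2 < s1"
      using eventually_happens'[of "at_right (0::real)"] by force
    \<comment> \<open>As \<open>s2 < s1\<close>, the curve is run through towards its limit point,
      from near \<open>-1\<close> to near 1 after applying \<open>S\<close>.\<close>
    define c where "c = (S \<circ> \<eta>) \<circ> linepath s1 s2"
    have seg: "path_image (linepath s1 s2) = {s2..s1}"
      using s2 by (simp add: closed_segment_eq_real_ivl)
    have etaim: "\<eta> ` {s2..s1} \<subseteq> ball 0 1"
      using \<eta>b s1 s2 by auto
    have "continuous_on {s2..s1} (S \<circ> \<eta>)"
      using etaim s1 s2
      by (intro continuous_on_compose continuous_on_subset[OF \<eta>(1)] continuous_on_subset[OF Scont]) auto
    then have pc: "path c"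
      unfolding c_def by (intro path_continuous_image) (auto simp only: seg path_linepath)
    have ic: "path_image c = S ` \<eta> ` {s2..s1}"
      unfolding c_def path_image_compose seg by (simp add: image_image)
    have "(cmod ((f \<circ> M) 0))\<^sup>2 \<le> 2 * max d (2 * d)"
    proof (rule two_constants_diameter[OF _ _ pc])
      show "f \<circ> M holomorphic_on ball 0 1"
      proof (rule holomorphic_on_compose_gen[OF _ holf])
        show "M holomorphic_on ball 0 1"
          unfolding M_def using w1 by (intro holomorphic_intros Moebius_function_holomorphic) auto
      qed (use Mball in auto)
      show "cmod ((f \<circ> M) z) \<le> 1" if "cmod z < 1" for z
        using f1 Mball[of z] that by simp
      show "path_image c \<subseteq> ball 0 1" using ic etaim Sball by auto
      show "dist (pathstart c) (-1) < d"
        using elim(1) by (simp add: c_def pathstart_compose S_def Moebius_function_simple A_def[symmetric])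
      show "dist (pathfinish c) 1 < d" using s2 by (simp add: c_def pathfinish_compose)
      show "cmod ((f \<circ> M) x) \<le> d" if x: "x \<in> path_image c" for x
      proof -
        obtain s where s: "s2 \<le> s" "s \<le> s1" "x = S (\<eta> s)" using x ic by auto
        then have "M x = \<eta> s" using MS[of "\<eta> s"] \<eta>b[of s] s1 s2 by auto
        then show ?thesis using s'(2)[of s] s s1 s2 by auto
      qed
    qed
    then have "2 * (cmod (f (of_real r * \<alpha>)))\<^sup>2 \<le> e\<^sup>2"
      using d by (simp add: M_def Moebius_function_of_zero mult.commute d_def)
    then have "(cmod (f (of_real r * \<alpha>)))\<^sup>2 < e\<^sup>2"
      using zero_less_power[OF e, of 2] zero_le_power2[of "cmod (f (of_real r * \<alpha>))"] by linarith
    then have "cmod (f (of_real r * \<alpha>)) < e" using e by (simp add: power2_less_imp_less)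
    then show ?case by simp
  qed
qed

subsection \<open>Limits of lifts at the ends\<close>

lemma eq_on_dense_subset:
  fixes f g :: "'a::metric_space \<Rightarrow> 'b::t2_space"
  assumes "continuous_on X f" "continuous_on X g" "A \<subseteq> X" "X \<subseteq> closure A"
    and "\<And>x. x \<in> A \<Longrightarrow> f x = g x" and "x \<in> X"
  shows "f x = g x"
proof -
  obtain a where a: "\<And>n. a n \<in> A" "a \<longlonglongrightarrow> x"
    using subsetD[OF assms(4,6)] unfolding closure_sequential by blast
  have "(\<lambda>n. f (a n)) \<longlonglongrightarrow> f x" "(\<lambda>n. g (a n)) \<longlonglongrightarrow> g x"
    using a(1) assms(3) subsetD
    by (auto intro!: continuous_on_tendsto_compose[OF assms(1) a(2) assms(6)]
        continuous_on_tendsto_compose[OF assms(2) a(2) assms(6)] always_eventually)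
  then show ?thesis using a(1) assms(5) by (simp add: LIMSEQ_unique)
qed

text \<open>Since \<open>p\<close> lies in \<open>\<Omega>\<close>, the homotopy also lifts over the
  edge \<open>s = 0\<close>. By uniqueness of lifts this lift \<open>K\<close> agrees with
  \<open>H\<close> off the edge and is constant on the edge, where \<open>h\<close> is constant.
  Uniform continuity of \<open>K\<close> makes the limit uniform in \<open>t\<close>, which is what
  continuity of the glued lift requires.\<close>

lemma lift_limit_at_interior_end:
  fixes h H :: "real \<times> real \<Rightarrow> complex"
  assumes cov: "covering_space (ball 0 1) \<phi> \<Omega>"
    and h: "continuous_on ({0..1} \<times> {0..1}) h" "\<And>t. t \<in> {0..1} \<Longrightarrow> h (0, t) = p"
      "h \<in> {0<..<1} \<times> {0..1} \<rightarrow> \<Omega>"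
    and H: "continuous_on ({0<..<1} \<times> {0..1}) H" "H \<in> {0<..<1} \<times> {0..1} \<rightarrow> ball 0 1"
      "\<And>x. x \<in> {0<..<1} \<times> {0..1} \<Longrightarrow> \<phi> (H x) = h x"
    and p: "p \<in> \<Omega>"
  shows "\<exists>ph\<in>ball 0 1. \<phi> ph = p \<and>
    (\<forall>e>0. \<exists>d>0. \<forall>s t. 0 < s \<longrightarrow> s < d \<longrightarrow> s < 1 \<longrightarrow> t \<in> {0..1} \<longrightarrow> dist (H (s, t)) ph < e)"
proof -
  \<comment> \<open>Stopping at \<open>1/2\<close> avoids the opposite edge, where \<open>h\<close>
    may leave \<open>\<Omega>\<close>.\<close>
  let ?W = "{0..1/2::real} \<times> {0..1::real}"
  have hW: "h \<in> ?W \<rightarrow> \<Omega>"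
  proof
    fix x assume "x \<in> ?W"
    then show "h x \<in> \<Omega>"
      using h(2,3) p by (cases x; cases "fst x = 0") (auto simp: Pi_iff)
  qed
  have contW: "continuous_on ?W h" by (rule continuous_on_subset[OF h(1)]) auto
  have cvx: "convex ?W" by (intro convex_Times) auto
  have "H (1/2, 0) \<in> ball 0 1" using H(2) by (auto simp: Pi_iff)
  then obtain K where K: "continuous_on ?W K" "K \<in> ?W \<rightarrow> ball 0 1" "K (1/2, 0) = H (1/2, 0)"
      "\<And>y. y \<in> ?W \<Longrightarrow> \<phi> (K y) = h y"
    using covering_space_lift_strong[OF cov, of "H (1/2, 0)" "(1/2, 0)" ?W h] contW hW H(3)[of "(1/2, 0)"]
      convex_imp_simply_connected[OF cvx] convex_imp_locally_path_connected[OF cvx] by auto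
  have KH: "K (s, t) = H (s, t)" if "0 < s" "s \<le> 1/2" "t \<in> {0..1}" for s t
  proof (rule covering_space_lift_unique[OF cov, of K "(1/2, 0)" H "{0<..1/2} \<times> {0..1}" h])
    have sub: "{0<..1/2} \<times> {0..1} \<subseteq> ?W" "{0<..1/2} \<times> {0..1} \<subseteq> {0<..<1::real} \<times> {0..1::real}" by auto
    show "continuous_on ({0<..1/2} \<times> {0..1}) h" "continuous_on ({0<..1/2} \<times> {0..1}) K"
      "continuous_on ({0<..1/2} \<times> {0..1}) H"
      using contW K(1) H(1) sub continuous_on_subset by blast+
    show "h \<in> {0<..1/2} \<times> {0..1} \<rightarrow> \<Omega>" "K \<in> {0<..1/2} \<times> {0..1} \<rightarrow> ball 0 1"
      "H \<in> {0<..1/2} \<times> {0..1} \<rightarrow> ball 0 1"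
      using hW K(2) H(2) sub by blast+
    show "h x = \<phi> (K x)" "h x = \<phi> (H x)" if "x \<in> {0<..1/2} \<times> {0..1}" for x
      using K(4)[of x] H(3)[of x] that by auto
    show "connected ({0<..1/2::real} \<times> {0..1::real})"
      by (intro convex_connected convex_Times) auto
  qed (use that K(3) in auto)
  have K0: "K (0, t) = K (0, 0)" if "t \<in> {0..1}" for t
  proof (rule covering_space_lift_unique[OF cov, of K "(0, 0)" "\<lambda>_. K (0, 0)" "{0} \<times> {0..1}" h])
    have sub: "{0} \<times> {0..1} \<subseteq> ?W" by auto
    show "continuous_on ({0} \<times> {0..1}) h" "continuous_on ({0} \<times> {0..1}) K"
      using contW K(1) sub continuous_on_subset by blast+
    show "h \<in> {0} \<times> {0..1} \<rightarrow> \<Omega>" "K \<in> {0} \<times> {0..1} \<rightarrow> ball 0 1"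
      using hW K(2) sub by blast+
    show "h x = \<phi> (K x)" if "x \<in> {0} \<times> {0..1}" for x
      using K(4)[of x] that by auto
    show "(\<lambda>_. K (0, 0)) \<in> {0} \<times> {0..1} \<rightarrow> ball 0 1"
      using K(2) by (auto simp: Pi_iff)
    show "h x = \<phi> (K (0, 0))" if "x \<in> {0} \<times> {0..1}" for x
      using K(4)[of "(0, 0)"] that h(2) by auto
    show "connected ({0::real} \<times> {0..1::real})"
      by (intro convex_connected convex_Times) auto
  qed (use that in auto)
  show ?thesis
  proof (intro bexI[of _ "K (0, 0)"] conjI allI impI)
    show "K (0, 0) \<in> ball 0 1" using K(2) by (auto simp: Pi_iff)
    show "\<phi> (K (0, 0)) = p" using K(4)[of "(0, 0)"] h(2) by auto
    fix e :: real assume "e > 0"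
    have "uniformly_continuous_on ?W K"
      using K(1) by (rule compact_uniformly_continuous) (auto intro: compact_Times)
    then obtain d where d: "d > 0" "\<And>x y. x \<in> ?W \<Longrightarrow> y \<in> ?W \<Longrightarrow> dist y x < d \<Longrightarrow> dist (K y) (K x) < e"
      using \<open>e > 0\<close> unfolding uniformly_continuous_on_def by metis
    show "\<exists>d>0. \<forall>s t. 0 < s \<longrightarrow> s < d \<longrightarrow> s < 1 \<longrightarrow> t \<in> {0..1} \<longrightarrow> dist (H (s, t)) (K (0, 0)) < e"
    proof (intro exI[of _ "min d (1/2)"] conjI allI impI)
      fix s t :: real assume st: "0 < s" "s < min d (1/2)" "t \<in> {0..1}"
      have "dist (K (s, t)) (K (0, t)) < e"
        using st by (intro d(2)) (auto simp: dist_Pair_Pair)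
      then show "dist (H (s, t)) (K (0, 0)) < e" using st KH[of s t] K0[of t] by simp
    qed (use d in auto)
  qed
qed

text \<open>The normalised function \<open>f\<close> is bounded by 1, has no zero because
  \<open>p\<close> is not in \<open>\<Omega>\<close>, and tends to \<open>0\<close> along the lift.
  Koebe's theorem therefore leaves a single accumulation point on the circle, and Lindelof's theorem
  gives the radial limit there. Letting \<open>t\<close> vary along with \<open>s\<close> in the
  accumulation argument makes the limit uniform in \<open>t\<close>.\<close>

lemma lift_limit_at_boundary_end:
  fixes h H :: "real \<times> real \<Rightarrow> complex"
  assumes bdd: "bounded \<Omega>" and hol: "\<phi> holomorphic_on ball 0 1"
    and cov: "\<phi> ` ball 0 1 \<subseteq> \<Omega>"
    and h: "continuous_on ({0..1} \<times> {0..1}) h" "\<And>t. t \<in> {0..1} \<Longrightarrow> h (0, t) = p"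
    and H: "continuous_on ({0<..<1} \<times> {0..1}) H" "H \<in> {0<..<1} \<times> {0..1} \<rightarrow> ball 0 1"
      "\<And>x. x \<in> {0<..<1} \<times> {0..1} \<Longrightarrow> \<phi> (H x) = h x"
    and p: "p \<notin> \<Omega>"
  shows "\<exists>ph. cmod ph = 1 \<and> ((\<lambda>r::real. \<phi> (of_real r * ph)) \<longlongrightarrow> p) (at_left 1) \<and>
    (\<forall>e>0. \<exists>d>0. \<forall>s t. 0 < s \<longrightarrow> s < d \<longrightarrow> s < 1 \<longrightarrow> t \<in> {0..1} \<longrightarrow> dist (H (s, t)) ph < e)"
proof -
  obtain B where B: "B > 0" "\<And>w. w \<in> \<Omega> \<Longrightarrow> cmod (w - p) \<le> B"
  proof -
    obtain b where "b > 0" "\<And>w. w \<in> \<Omega> \<Longrightarrow> cmod w \<le> b"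
      using bdd unfolding bounded_pos by blast
    then show ?thesis
      using that[of "b + cmod p"] norm_triangle_ineq4[of _ p]
      by (smt (verit) norm_ge_zero)
  qed
  define f where "f z = (\<phi> z - p) / of_real B" for z
  have holf: "f holomorphic_on ball 0 1"
    unfolding f_def using B(1) by (intro holomorphic_intros hol) auto
  have f1: "cmod (f z) \<le> 1" if "cmod z < 1" for z
    using B that cov by (auto simp: f_def norm_divide image_subset_iff)
  have f_nz: "f z \<noteq> 0" if "cmod z < 1" for z
    using B(1) that cov p by (auto simp: f_def image_subset_iff)
  have near: "\<exists>d>0. \<forall>s t. 0 < s \<longrightarrow> s < d \<longrightarrow> s < 1 \<longrightarrow> t \<in> {0..1} \<longrightarrow> dist (h (s, t)) p < e"
    if e: "e > 0" for e
  proof -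
    have "uniformly_continuous_on ({0..1} \<times> {0..1}) h"
      using h(1) by (rule compact_uniformly_continuous) (auto intro: compact_Times)
    then obtain d where d: "d > 0" "\<And>x y. x \<in> {0..1} \<times> {0..1} \<Longrightarrow> y \<in> {0..1} \<times> {0..1} \<Longrightarrow>
        dist y x < d \<Longrightarrow> dist (h y) (h x) < e"
      using e unfolding uniformly_continuous_on_def by metis
    have "dist (h (s, t)) p < e" if "0 < s" "s < d" "s < 1" "t \<in> {0..1}" for s t
      using d(2)[of "(0, t)" "(s, t)"] that h(2) by (auto simp: dist_Pair_Pair)
    then show ?thesis using d(1) by blast
  qed
  have fsmall: "\<exists>d>0. \<forall>s t. 0 < s \<longrightarrow> s < d \<longrightarrow> s < 1 \<longrightarrow> t \<in> {0..1} \<longrightarrow> cmod (f (H (s, t))) < e"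
    if e: "e > 0" for e
  proof -
    have "e * B > 0" using e B by simp
    from near[OF this] obtain d where "d > 0"
      and d: "\<And>s t. 0 < s \<Longrightarrow> s < d \<Longrightarrow> s < 1 \<Longrightarrow> t \<in> {0..1} \<Longrightarrow> dist (h (s, t)) p < e * B" by blast
    have "cmod (f (H (s, t))) < e" if "0 < s" "s < d" "s < 1" "t \<in> {0..1}" for s t
      using d[OF that] H(3)[of "(s, t)"] that B(1)
      by (auto simp: f_def norm_divide dist_norm divide_simps)
    with \<open>d > 0\<close> show ?thesis by blast
  qed
  \<comment> \<open>An accumulation point inside the disc would be mapped to \<open>p\<close> by
    continuity of \<open>\<phi>\<close>, but \<open>p\<close> is not a value of
    \<open>\<phi>\<close>.\<close>
  have cluster: "\<exists>a r. cmod a = 1 \<and> strict_mono r \<and> (\<lambda>n. H (x (r n))) \<longlonglongrightarrow> a"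
    if x: "\<And>n. x n \<in> {0<..<1} \<times> {0..1}" "(\<lambda>n. fst (x n)) \<longlonglongrightarrow> 0" for x :: "nat \<Rightarrow> real \<times> real"
  proof -
    have Hx: "H (x n) \<in> ball 0 1" for n using H(2) x(1) by blast
    have "\<forall>n. (H \<circ> x) n \<in> cball 0 1" using Hx by (simp add: less_imp_le)
    then obtain a r where a: "a \<in> cball 0 1" "strict_mono r" "(H \<circ> x \<circ> r) \<longlonglongrightarrow> a"
      using compact_cball[of "0::complex" 1] unfolding compact_def by blast
    then have a: "a \<in> cball 0 1" "strict_mono r" "(\<lambda>n. H (x (r n))) \<longlonglongrightarrow> a"
      by (auto simp: o_def)
    have "cmod a = 1"
    proof (rule ccontr)
      assume "cmod a \<noteq> 1"
      then have ab: "a \<in> ball 0 1" using a(1) by simp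
      have "(\<lambda>n. \<phi> (H (x (r n)))) \<longlonglongrightarrow> \<phi> a"
        by (rule continuous_on_tendsto_compose[OF holomorphic_on_imp_continuous_on[OF hol] a(3) ab])
          (intro always_eventually allI Hx)
      moreover have "(\<lambda>n. \<phi> (H (x (r n)))) \<longlonglongrightarrow> p"
      proof (rule tendstoI)
        fix e :: real assume "e > 0"
        from near[OF this] obtain d where "d > 0"
          and d: "\<And>s t. 0 < s \<Longrightarrow> s < d \<Longrightarrow> s < 1 \<Longrightarrow> t \<in> {0..1} \<Longrightarrow> dist (h (s, t)) p < e" by blast
        have "(\<lambda>n. fst (x (r n))) \<longlonglongrightarrow> 0"
          using LIMSEQ_subseq_LIMSEQ[OF x(2) a(2)] by (simp add: o_def)
        then have "eventually (\<lambda>n. fst (x (r n)) < d) sequentially"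
          using \<open>d > 0\<close> by (rule order_tendstoD)
        then show "eventually (\<lambda>n. dist (\<phi> (H (x (r n)))) p < e) sequentially"
        proof eventually_elim
          case (elim n)
          then show ?case
            using H(3)[OF x(1)[of "r n"]] d[of "fst (x (r n))" "snd (x (r n))"] x(1)[of "r n"]
            by (auto simp: mem_Times_iff)
        qed
      qed
      ultimately have "\<phi> a = p" by (rule LIMSEQ_unique)
      then show False using ab cov p by blast
    qed
    with a show ?thesis by blast
  qed
  have inv_lim: "(\<lambda>n. inverse (real (Suc (Suc n)))) \<longlonglongrightarrow> 0"
    using LIMSEQ_Suc[OF LIMSEQ_inverse_real_of_nat] by simp
  \<comment> \<open>The double \<open>Suc\<close> keeps the first coordinate strictly below
    1.\<close>
  define x where "x n = (inverse (real (Suc (Suc n))), 0::real)" for n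
  have x: "x n \<in> {0<..<1} \<times> {0..1}" "(\<lambda>n. fst (x n)) \<longlonglongrightarrow> 0" for n
    using inv_lim by (auto simp: x_def inverse_less_1_iff)
  obtain a r where a: "cmod a = 1" "strict_mono r" "(\<lambda>n. H (x (r n))) \<longlonglongrightarrow> a"
    using cluster[of x] x by blast
  \<comment> \<open>If this fails, some sequence \<open>y\<close> accumulates at a point
    \<open>b\<close> other than \<open>a\<close>. Segments joining late terms of the two sequences
    are lifted by \<open>H\<close> to arcs on which \<open>f\<close> is small, so Koebe's theorem
    forces a zero of \<open>f\<close>.\<close>
  have unif: "\<exists>d>0. \<forall>s t. 0 < s \<longrightarrow> s < d \<longrightarrow> s < 1 \<longrightarrow> t \<in> {0..1} \<longrightarrow> dist (H (s, t)) a < e"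
    if e: "e > 0" for e
  proof (rule ccontr)
    assume neg: "\<not> ?thesis"
    have "\<exists>y. y \<in> {0<..<1} \<times> {0..1} \<and> fst y < inverse (real (Suc (Suc n))) \<and> dist (H y) a \<ge> e" for n
    proof -
      have "inverse (real (Suc (Suc n))) > 0" by simp
      with neg obtain s t where "0 < s" "s < inverse (real (Suc (Suc n)))" "s < 1" "t \<in> {0..1}"
          "\<not> dist (H (s, t)) a < e" by blast
      then show ?thesis by (intro exI[of _ "(s, t)"]) auto
    qed
    then obtain y where y: "\<And>n. y n \<in> {0<..<1} \<times> {0..1}"
        "\<And>n. fst (y n) < inverse (real (Suc (Suc n)))" "\<And>n. dist (H (y n)) a \<ge> e"
      by metis
    have y0: "(\<lambda>n. fst (y n)) \<longlonglongrightarrow> 0"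
    proof (rule tendsto_sandwich[OF _ _ tendsto_const inv_lim])
      show "eventually (\<lambda>n. 0 \<le> fst (y n)) sequentially"
        using y(1) by (intro always_eventually allI less_imp_le) (auto simp: mem_Times_iff)
      show "eventually (\<lambda>n. fst (y n) \<le> inverse (real (Suc (Suc n)))) sequentially"
        by (intro always_eventually allI less_imp_le y(2))
    qed
    obtain b r' where b: "cmod b = 1" "strict_mono r'" "(\<lambda>n. H (y (r' n))) \<longlonglongrightarrow> b"
      using cluster[of y] y(1) y0 by blast
    have "dist b a \<ge> e"
      by (rule LIMSEQ_le_const[OF tendsto_dist[OF b(3) tendsto_const]]) (use y(3) in auto)
    then have "a \<noteq> b" using e by auto
    have "vanishes_along_arcs f a b"
      unfolding vanishes_along_arcs_def
    proof (intro allI impI)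
      fix \<epsilon> :: real assume \<epsilon>: "\<epsilon> > 0"
      from fsmall[OF this] obtain d where "d > 0"
        and d: "\<And>s t. 0 < s \<Longrightarrow> s < d \<Longrightarrow> s < 1 \<Longrightarrow> t \<in> {0..1} \<Longrightarrow> cmod (f (H (s, t))) < \<epsilon>" by blast
      have pick: "\<exists>v. v \<in> {0<..<min d 1} \<times> {0..1} \<and> dist (H v) a' < \<epsilon>"
        if v: "\<And>n. v n \<in> {0<..<1} \<times> {0..1}" "(\<lambda>n. fst (v n)) \<longlonglongrightarrow> 0" "strict_mono k"
          "(\<lambda>n. H (v (k n))) \<longlonglongrightarrow> a'" for v :: "nat \<Rightarrow> real \<times> real" and k a'
      proof -
        have "(\<lambda>n. fst (v (k n))) \<longlonglongrightarrow> 0"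
          using LIMSEQ_subseq_LIMSEQ[OF v(2,3)] by (simp add: o_def)
        then have "eventually (\<lambda>n. fst (v (k n)) < d) sequentially"
          using \<open>d > 0\<close> by (rule order_tendstoD)
        moreover have "eventually (\<lambda>n. dist (H (v (k n))) a' < \<epsilon>) sequentially"
          using v(4) \<epsilon> by (rule tendstoD)
        ultimately have "eventually (\<lambda>n. fst (v (k n)) < d \<and> dist (H (v (k n))) a' < \<epsilon>) sequentially"
          by (rule eventually_conj)
        then obtain n where "fst (v (k n)) < d" "dist (H (v (k n))) a' < \<epsilon>"
          using eventually_happens'[OF sequentially_bot] by blast
        then show ?thesis
          using v(1)[of "k n"] by (intro exI[of _ "v (k n)"]) (auto simp: mem_Times_iff)
      qed
      obtain v where v: "v \<in> {0<..<min d 1} \<times> {0..1}" "dist (H v) a < \<epsilon>"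
        using pick[OF x a(2,3)] by blast
      obtain w where w: "w \<in> {0<..<min d 1} \<times> {0..1}" "dist (H w) b < \<epsilon>"
        using pick[OF y(1) y0 b(2,3)] by blast
      define c where "c = H \<circ> linepath v w"
      \<comment> \<open>The part of the strip with \<open>s\<close> below \<open>min d 1\<close> is
        convex, so the smallness of \<open>f\<close> at the two ends persists along the whole
        segment, even between different values of \<open>t\<close>.\<close>
      have seg: "closed_segment v w \<subseteq> {0<..<min d 1} \<times> {0..1}"
        using v(1) w(1) by (intro closed_segment_subset convex_Times) auto
      moreover have "{0<..<min d 1} \<times> {0..1} \<subseteq> {0<..<1::real} \<times> {0..1::real}" by auto
      ultimately have seg1: "closed_segment v w \<subseteq> {0<..<1} \<times> {0..1}" by (rule order_trans)
      have "path c"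
        unfolding c_def using seg1
        by (intro path_continuous_image continuous_on_subset[OF H(1)]) simp_all
      moreover have ic: "path_image c = H ` closed_segment v w"
        by (simp add: c_def path_image_compose)
      moreover have "H ` closed_segment v w \<subseteq> ball 0 1" using seg1 H(2) by blast
      moreover have "\<forall>x\<in>H ` closed_segment v w. cmod (f x) < \<epsilon>"
      proof
        fix x assume "x \<in> H ` closed_segment v w"
        then obtain s t where "x = H (s, t)" "(s, t) \<in> {0<..<min d 1} \<times> {0..1}"
          using seg by (metis imageE subsetD surj_pair)
        then show "cmod (f x) < \<epsilon>" using d[of s t] by simp
      qed
      moreover have "pathstart c = H v" "pathfinish c = H w"
        by (simp_all add: c_def pathstart_compose pathfinish_compose)
      ultimately show "\<exists>c. path c \<and> path_image c \<subseteq> ball 0 1 \<and> dist (pathstart c) a < \<epsilon> \<and>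
          dist (pathfinish c) b < \<epsilon> \<and> (\<forall>x\<in>path_image c. cmod (f x) < \<epsilon>)"
        using v(2) w(2) by (intro exI[of _ c]) simp
    qed
    then have "f 0 = 0" using Koebe_arcs[OF holf f1 a(1) b(1) \<open>a \<noteq> b\<close>] by simp
    then show False using f_nz[of 0] by simp
  qed
  \<comment> \<open>The slice \<open>t = 0\<close> of the lift serves as the curve ending at
    \<open>a\<close>.\<close>
  have "((\<lambda>r::real. f (of_real r * a)) \<longlongrightarrow> 0) (at_left 1)"
  proof (rule Lindelof_radial_limit[OF holf f1 _ _ _ _ a(1)])
    show "continuous_on {0<..<1} (\<lambda>s. H (s, 0))"
      by (rule continuous_on_compose2[OF H(1)]) (auto intro!: continuous_intros)
    show "(\<lambda>s. H (s, 0)) ` {0<..<1} \<subseteq> ball 0 1" using H(2) by (auto simp: Pi_iff)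
    have ev1: "eventually (\<lambda>s::real. s \<in> {0<..<d}) (at_right 0)" if "d > 0" for d
      using that by (rule eventually_at_right_real)
    show "((\<lambda>s. H (s, 0)) \<longlongrightarrow> a) (at_right 0)"
    proof (rule tendstoI)
      fix e :: real assume "e > 0"
      from unif[OF this] obtain d where "d > 0"
        and d: "\<And>s t. 0 < s \<Longrightarrow> s < d \<Longrightarrow> s < 1 \<Longrightarrow> t \<in> {0..1} \<Longrightarrow> dist (H (s, t)) a < e" by blast
      then show "eventually (\<lambda>s. dist (H (s, 0)) a < e) (at_right 0)"
        using ev1[of "min d 1"] by (auto elim!: eventually_mono)
    qed
    show "((\<lambda>s. f (H (s, 0))) \<longlongrightarrow> 0) (at_right 0)"
    proof (rule tendstoI)
      fix e :: real assume "e > 0"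
      from fsmall[OF this] obtain d where "d > 0"
        and d: "\<And>s t. 0 < s \<Longrightarrow> s < d \<Longrightarrow> s < 1 \<Longrightarrow> t \<in> {0..1} \<Longrightarrow> cmod (f (H (s, t))) < e" by blast
      then show "eventually (\<lambda>s. dist (f (H (s, 0))) 0 < e) (at_right 0)"
        using ev1[of "min d 1"] by (auto elim!: eventually_mono)
    qed
  qed auto
  then have "((\<lambda>r::real. of_real B * f (of_real r * a) + p) \<longlongrightarrow> of_real B * 0 + p) (at_left 1)"
    by (intro tendsto_intros)
  then have "((\<lambda>r::real. \<phi> (of_real r * a)) \<longlongrightarrow> p) (at_left 1)"
    using B(1) by (simp add: f_def)
  with a(1) unif show ?thesis by blast
qed

section \<open>The extended map and the limit of a lift at an arbitrary endpoint\<close>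

lemma ext_phi_ball: "w \<in> ball 0 1 \<Longrightarrow> w \<in> ext_dom \<phi> \<and> ext_phi \<phi> w = \<phi> w"
  by (simp add: ext_dom_def ext_phi_def)

lemma ext_phi_radial_limit:
  assumes "cmod w = 1" "((\<lambda>r::real. \<phi> (of_real r * w)) \<longlongrightarrow> l) (at_left 1)"
  shows "w \<in> ext_dom \<phi> \<and> ext_phi \<phi> w = l"
  using assms tendsto_Lim[OF _ assms(2)] by (auto simp: ext_dom_def ext_phi_def)

lemma ext_dom_subset_cball: "ext_dom \<phi> \<subseteq> cball 0 1"
  by (auto simp: ext_dom_def)

text \<open>Unites the interior and the boundary case in terms of the extended map. The end
  \<open>s = 1\<close> reduces to this one by reversing \<open>s\<close>.\<close>

lemma lift_limit_at_end:
  fixes h H :: "real \<times> real \<Rightarrow> complex"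
  assumes bdd: "bounded \<Omega>" and hol: "\<phi> holomorphic_on ball 0 1"
    and cov: "covering_space (ball 0 1) \<phi> \<Omega>"
    and h: "continuous_on ({0..1} \<times> {0..1}) h" "\<And>t. t \<in> {0..1} \<Longrightarrow> h (0, t) = p"
      "h \<in> {0<..<1} \<times> {0..1} \<rightarrow> \<Omega>"
    and H: "continuous_on ({0<..<1} \<times> {0..1}) H" "H \<in> {0<..<1} \<times> {0..1} \<rightarrow> ball 0 1"
      "\<And>x. x \<in> {0<..<1} \<times> {0..1} \<Longrightarrow> \<phi> (H x) = h x"
  obtains ph where "ph \<in> ext_dom \<phi>" "ext_phi \<phi> ph = p"
    "\<And>e. e > 0 \<Longrightarrow> \<exists>d>0. \<forall>s t. 0 < s \<longrightarrow> s < d \<longrightarrow> s < 1 \<longrightarrow> t \<in> {0..1} \<longrightarrow> dist (H (s, t)) ph < e"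
proof (cases "p \<in> \<Omega>")
  case True
  then show ?thesis
    using lift_limit_at_interior_end[OF cov h H] ext_phi_ball that by metis
next
  case False
  have "\<phi> ` ball 0 1 \<subseteq> \<Omega>" using cov covering_space_imp_surjective by blast
  then show ?thesis
    using lift_limit_at_boundary_end[OF bdd hol _ h(1,2) H False] ext_phi_radial_limit that by metis
qed

subsection \<open>Lifting of homotopies\<close>

text \<open>The base point \<open>(s0, 0)\<close> may lie on a vertical edge, so it is added to the
  domain of the lift; convexity keeps this domain simply connected and locally path connected. Of
  two distinct points of the set one lies in the strip, so every proper convex combination has first
  coordinate strictly between 0 and 1.\<close>

lemma convex_insert_open_strip:
  fixes s0 :: real
  assumes "s0 \<in> {0..1}"
  shows "convex (insert (s0, 0) ({0<..<1} \<times> {0..1::real}))" (is "convex ?X")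
proof (rule convexI)
  fix x y :: "real \<times> real" and u v :: real
  assume xy: "x \<in> ?X" "y \<in> ?X" and uv: "0 \<le> u" "0 \<le> v" "u + v = 1"
  show "u *\<^sub>R x + v *\<^sub>R y \<in> ?X"
  proof (cases "u = 0 \<or> v = 0 \<or> x = y")
    case True
    then have "u *\<^sub>R x + v *\<^sub>R y = x \<or> u *\<^sub>R x + v *\<^sub>R y = y"
      using uv by (auto simp: scaleR_left_distrib[symmetric])
    then show ?thesis using xy by auto
  next
    case False
    then have pos: "u > 0" "v > 0" using uv by auto
    have comb: "0 < u * a + v * b \<and> u * a + v * b < 1"
      if "0 \<le> a" "a \<le> 1" "0 \<le> b" "b \<le> 1" "a \<in> {0<..<1} \<or> b \<in> {0<..<1}" for a b
    proof -
      have "u * a \<ge> 0" "v * b \<ge> 0" "u * a \<le> u" "v * b \<le> v"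
        using that pos by (auto simp: mult_left_le)
      moreover have "(0 < u * a \<and> u * a < u) \<or> (0 < v * b \<and> v * b < v)"
        using that(5) pos by auto
      ultimately show ?thesis using uv(3) by linarith
    qed
    have bounds: "0 \<le> fst x" "fst x \<le> 1" "0 \<le> fst y" "fst y \<le> 1" "0 \<le> snd x" "snd x \<le> 1"
        "0 \<le> snd y" "snd y \<le> 1"
      using xy assms by auto
    have "fst x \<in> {0<..<1} \<or> fst y \<in> {0<..<1}" using xy False by auto
    with comb bounds have "0 < u * fst x + v * fst y" "u * fst x + v * fst y < 1" by blast+
    moreover have "0 \<le> u * snd x + v * snd y" using bounds pos by simp
    moreover have "u * snd x + v * snd y \<le> 1" using bounds uv by (intro convex_bound_le)
    ultimately show ?thesis by (auto simp: mem_Times_iff)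
  qed
qed

text \<open>Because the limits at both ends are uniform in \<open>t\<close>, a constant value on
  each vertical edge extends \<open>H\<close> continuously; for \<open>0 < s < 1\<close> nothing
  changes locally.\<close>

lemma continuous_on_glue_ends:
  fixes H :: "real \<times> real \<Rightarrow> complex"
  assumes H: "continuous_on ({0<..<1} \<times> {0..1}) H"
    and p: "\<And>e. e > 0 \<Longrightarrow> \<exists>d>0. \<forall>s t. 0 < s \<longrightarrow> s < d \<longrightarrow> s < 1 \<longrightarrow> t \<in> {0..1} \<longrightarrow> dist (H (s, t)) ph < e"
    and q: "\<And>e. e > 0 \<Longrightarrow> \<exists>d>0. \<forall>s t. 0 < s \<longrightarrow> s < d \<longrightarrow> s < 1 \<longrightarrow> t \<in> {0..1} \<longrightarrow> dist (H (1 - s, t)) qh < e"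
  shows "continuous_on ({0..1} \<times> {0..1}) (\<lambda>x. if fst x = 0 then ph else if fst x = 1 then qh else H x)"
    (is "continuous_on ?Q ?g")
  unfolding continuous_on_eq_continuous_within
proof
  fix x :: "real \<times> real" assume x: "x \<in> ?Q"
  obtain s t where st: "x = (s, t)" by (cases x)
  consider "s = 0" | "s = 1" | "0 < s" "s < 1" using x st by force
  then show "continuous (at x within ?Q) ?g"
  proof cases
    case 1
    show ?thesis
      unfolding continuous_within_eps_delta
    proof (intro allI impI)
      fix e :: real assume "e > 0"
      from p[OF this] obtain d where d: "d > 0"
        "\<And>s t. 0 < s \<Longrightarrow> s < d \<Longrightarrow> s < 1 \<Longrightarrow> t \<in> {0..1} \<Longrightarrow> dist (H (s, t)) ph < e" by blast
      show "\<exists>d>0. \<forall>x'\<in>?Q. dist x' x < d \<longrightarrow> dist (?g x') (?g x) < e"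
      proof (intro exI[of _ "min d 1"] conjI ballI impI)
        fix x' assume x': "x' \<in> ?Q" "dist x' x < min d 1"
        then have "fst x' < min d 1"
          using dist_fst_le[of x' x] st 1 by (auto simp: dist_real_def)
        then show "dist (?g x') (?g x) < e"
          using d(2)[of "fst x'" "snd x'"] x' st 1 \<open>e > 0\<close> by (auto simp: mem_Times_iff)
      qed (use d in auto)
    qed
  next
    case 2
    show ?thesis
      unfolding continuous_within_eps_delta
    proof (intro allI impI)
      fix e :: real assume "e > 0"
      from q[OF this] obtain d where d: "d > 0"
        "\<And>s t. 0 < s \<Longrightarrow> s < d \<Longrightarrow> s < 1 \<Longrightarrow> t \<in> {0..1} \<Longrightarrow> dist (H (1 - s, t)) qh < e" by blast
      show "\<exists>d>0. \<forall>x'\<in>?Q. dist x' x < d \<longrightarrow> dist (?g x') (?g x) < e"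
      proof (intro exI[of _ "min d 1"] conjI ballI impI)
        fix x' assume x': "x' \<in> ?Q" "dist x' x < min d 1"
        then have "1 - fst x' < min d 1"
          using dist_fst_le[of x' x] st 2 by (auto simp: dist_real_def)
        then show "dist (?g x') (?g x) < e"
          using d(2)[of "1 - fst x'" "snd x'"] x' st 2 \<open>e > 0\<close> by (auto simp: mem_Times_iff)
      qed (use d in auto)
    qed
  next
    case 3
    have "continuous_on ({0<..<1} \<times> {0..1}) ?g"
      using H by (rule continuous_on_eq) auto
    then have "continuous (at x within {0<..<1} \<times> {0..1}) ?g"
      using x st 3 by (auto simp: continuous_on_eq_continuous_within)
    moreover have "at x within ?Q = at x within {0<..<1} \<times> {0..1}"
      by (rule at_within_nhd[of _ "{0<..<1} \<times> UNIV"]) (use st 3 in \<open>auto intro: open_Times\<close>)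
    ultimately show ?thesis by simp
  qed
qed

text \<open>Covering theory lifts \<open>h\<close> on the open strip together with the base point;
  the limits at both ends then extend the lift to the closed square.\<close>

lemma homotopy_lift_ext:
  fixes \<Omega> :: "complex set" and \<phi> :: "complex \<Rightarrow> complex" and h :: "real \<times> real \<Rightarrow> complex"
  assumes bdd: "bounded \<Omega>" and hol: "\<phi> holomorphic_on ball 0 1"
    and cov: "covering_space (ball 0 1) \<phi> \<Omega>"
    and z: "z \<in> \<Omega>" and zh: "zh \<in> ball 0 1" "\<phi> zh = z"
    and hcont: "continuous_on ({0..1} \<times> {0..1}) h"
    and hpath: "\<forall>t\<in>{0..1}. path_epe \<Omega> p q (\<lambda>s. h (s, t))"
    and s0: "s0 \<in> {0..1}" "h (s0, 0) = z"
  shows "\<exists>hh. continuous_on ({0..1} \<times> {0..1}) hh \<and>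
            hh ` ({0..1} \<times> {0..1}) \<subseteq> cball 0 1 \<and>
            (\<forall>s\<in>{0<..<1}. \<forall>t\<in>{0..1}. hh (s, t) \<in> ball 0 1 \<and> \<phi> (hh (s, t)) = h (s, t)) \<and>
            (\<exists>ph. hh ` ({0} \<times> {0..1}) = {ph} \<and> ph \<in> ext_dom \<phi> \<and> ext_phi \<phi> ph = p) \<and>
            (\<exists>qh. hh ` ({1} \<times> {0..1}) = {qh} \<and> qh \<in> ext_dom \<phi> \<and> ext_phi \<phi> qh = q) \<and>
            hh (s0, 0) = zh"
proof -
  let ?R = "{0<..<1::real} \<times> {0..1::real}"
  let ?X = "insert (s0, 0) ?R"
  have hR: "h \<in> ?R \<rightarrow> \<Omega>" and h0: "\<And>t. t \<in> {0..1} \<Longrightarrow> h (0, t) = p" and h1: "\<And>t. t \<in> {0..1} \<Longrightarrow> h (1, t) = q"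
    using hpath unfolding path_epe_def by auto
  have XQ: "?X \<subseteq> {0..1} \<times> {0..1}" using s0(1) by auto
  have cvx: "convex ?X" using s0(1) by (rule convex_insert_open_strip)
  have hX: "continuous_on ?X h" "h \<in> ?X \<rightarrow> \<Omega>"
    using continuous_on_subset[OF hcont XQ] hR s0(2) z by auto
  obtain H where H: "continuous_on ?X H" "H \<in> ?X \<rightarrow> ball 0 1" "H (s0, 0) = zh"
      "\<And>y. y \<in> ?X \<Longrightarrow> \<phi> (H y) = h y"
    using covering_space_lift_strong[OF cov zh(1) _ convex_imp_simply_connected[OF cvx]
        convex_imp_locally_path_connected[OF cvx] hX, of "(s0, 0)"] s0(2) zh(2) by auto
  have HR: "continuous_on ?R H" "H \<in> ?R \<rightarrow> ball 0 1" "\<And>y. y \<in> ?R \<Longrightarrow> \<phi> (H y) = h y"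
    using continuous_on_subset[OF H(1)] H(2,4) by auto
  obtain ph where ph: "ph \<in> ext_dom \<phi>" "ext_phi \<phi> ph = p"
    "\<And>e. e > 0 \<Longrightarrow> \<exists>d>0. \<forall>s t. 0 < s \<longrightarrow> s < d \<longrightarrow> s < 1 \<longrightarrow> t \<in> {0..1} \<longrightarrow> dist (H (s, t)) ph < e"
    using lift_limit_at_end[OF bdd hol cov hcont h0 hR HR] by blast
  \<comment> \<open>The reflection exchanges the two vertical edges and so reduces the end
    \<open>q\<close> to the end \<open>s = 0\<close>.\<close>
  define r where "r x = (1 - fst x, snd x)" for x :: "real \<times> real"
  have rcont: "continuous_on S r" for S unfolding r_def by (intro continuous_intros)
  have rR: "r x \<in> ?R" if "x \<in> ?R" for x using that by (auto simp: r_def)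
  obtain qh where qh: "qh \<in> ext_dom \<phi>" "ext_phi \<phi> qh = q"
    "\<And>e. e > 0 \<Longrightarrow> \<exists>d>0. \<forall>s t. 0 < s \<longrightarrow> s < d \<longrightarrow> s < 1 \<longrightarrow> t \<in> {0..1} \<longrightarrow> dist ((H \<circ> r) (s, t)) qh < e"
  proof (rule lift_limit_at_end[OF bdd hol cov, of "h \<circ> r" q "H \<circ> r"])
    show "continuous_on ({0..1} \<times> {0..1}) (h \<circ> r)"
      by (intro continuous_on_compose rcont continuous_on_subset[OF hcont]) (auto simp: r_def)
    show "(h \<circ> r) (0, t) = q" if "t \<in> {0..1}" for t using h1 that by (simp add: r_def)
    show "h \<circ> r \<in> ?R \<rightarrow> \<Omega>" "H \<circ> r \<in> ?R \<rightarrow> ball 0 1" using hR HR(2) rR by fastforce+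
    show "continuous_on ?R (H \<circ> r)"
      by (intro continuous_on_compose rcont continuous_on_subset[OF HR(1)]) (use rR in blast)
    show "\<phi> ((H \<circ> r) x) = (h \<circ> r) x" if "x \<in> ?R" for x using HR(3) rR[OF that] by simp
  qed auto
  define hh where "hh x = (if fst x = 0 then ph else if fst x = 1 then qh else H x)" for x :: "real \<times> real"
  have hhcont: "continuous_on ({0..1} \<times> {0..1}) hh"
    unfolding hh_def by (rule continuous_on_glue_ends[OF HR(1) ph(3)]) (use qh(3) in \<open>auto simp: r_def\<close>)
  have hhR: "hh x = H x" if "x \<in> ?R" for x using that by (auto simp: hh_def)
  \<comment> \<open>For \<open>s0\<close> equal to 0 or 1 the value of \<open>hh\<close> here is
    \<open>ph\<close> or \<open>qh\<close> by definition. It is identified with \<open>zh\<close>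
    because \<open>hh\<close> and \<open>H\<close> are both continuous at the base point and agree
    on the dense strip.\<close>
  have "hh (s0, 0) = H (s0, 0)"
  proof (rule eq_on_dense_subset[OF _ H(1)])
    show "continuous_on ?X hh" using continuous_on_subset[OF hhcont XQ] .
    show "?X \<subseteq> closure ?R" using XQ by (simp add: closure_Times)
  qed (use hhR in auto)
  then have "hh (s0, 0) = zh" by (simp add: H(3))
  moreover have "hh ` ({0..1} \<times> {0..1}) \<subseteq> cball 0 1"
  proof
    fix w assume "w \<in> hh ` ({0..1} \<times> {0..1})"
    then obtain x where x: "x \<in> {0..1} \<times> {0..1}" "w = hh x" by blast
    have "H x \<in> ball 0 1" if "x \<in> ?R" using HR(2) that by blast
    then show "w \<in> cball 0 1"
      using ph(1) qh(1) ext_dom_subset_cball[of \<phi>] x by (auto simp: hh_def mem_Times_iff)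
  qed
  moreover have "hh (s, t) \<in> ball 0 1 \<and> \<phi> (hh (s, t)) = h (s, t)" if "s \<in> {0<..<1}" "t \<in> {0..1}" for s t
  proof -
    have "(s, t) \<in> ?R" using that by simp
    then show ?thesis using hhR HR(2,3) by (metis PiE)
  qed
  moreover have "hh ` ({0} \<times> {0..1}) = {ph}" "hh ` ({1} \<times> {0..1}) = {qh}"
    by (force simp: hh_def image_iff)+
  ultimately show ?thesis using hhcont ph(1,2) qh(1,2) by (intro exI[of _ hh]) blast
qed

text \<open>Lifts that agree at the base point agree on the connected set formed by it and the
  strip, and then on the closed square by density.\<close>

lemma homotopy_lift_ext_unique:
  fixes \<Omega> :: "complex set" and \<phi> :: "complex \<Rightarrow> complex" and h :: "real \<times> real \<Rightarrow> complex"
  assumes cov: "covering_space (ball 0 1) \<phi> \<Omega>"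
    and z: "z \<in> \<Omega>" and zh: "zh \<in> ball 0 1" "\<phi> zh = z"
    and hcont: "continuous_on ({0..1} \<times> {0..1}) h"
    and hpath: "\<forall>t\<in>{0..1}. path_epe \<Omega> p q (\<lambda>s. h (s, t))"
    and s0: "s0 \<in> {0..1}" "h (s0, 0) = z"
    and f: "continuous_on ({0..1} \<times> {0..1}) f"
      "\<forall>s\<in>{0<..<1}. \<forall>t\<in>{0..1}. f (s, t) \<in> ball 0 1 \<and> \<phi> (f (s, t)) = h (s, t)" "f (s0, 0) = zh"
    and g: "continuous_on ({0..1} \<times> {0..1}) g"
      "\<forall>s\<in>{0<..<1}. \<forall>t\<in>{0..1}. g (s, t) \<in> ball 0 1 \<and> \<phi> (g (s, t)) = h (s, t)" "g (s0, 0) = zh"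
    and x: "x \<in> {0..1} \<times> {0..1}"
  shows "f x = g x"
proof (rule eq_on_dense_subset[OF f(1) g(1) _ _ _ x])
  let ?R = "{0<..<1::real} \<times> {0..1::real}"
  let ?X = "insert (s0, 0) ?R"
  have XQ: "?X \<subseteq> {0..1} \<times> {0..1}" using s0(1) by auto
  show "{0..1} \<times> {0..1} \<subseteq> closure ?R" by (simp add: closure_Times)
  show "f y = g y" if y: "y \<in> ?R" for y
  \<comment> \<open>At the base point both functions lift \<open>h\<close> because
    \<open>\<phi> zh = z = h (s0, 0)\<close>, so it may serve as the common point even on an
    edge.\<close>
  proof (rule covering_space_lift_unique[OF cov, of f "(s0, 0)" g ?X h])
    show "h \<in> ?X \<rightarrow> \<Omega>" using hpath s0(2) z unfolding path_epe_def by auto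
    show "continuous_on ?X h" "continuous_on ?X f" "continuous_on ?X g"
      using hcont f(1) g(1) XQ continuous_on_subset by blast+
    show "connected ?X" using convex_connected convex_insert_open_strip[OF s0(1)] by blast
  qed (use f g s0 zh y in auto)
qed auto

section \<open>Lifting of paths and of homotopies with endpoints in the closure\<close>

theorem theorem2p4:
  fixes \<Omega> :: "complex set" and \<phi> :: "complex \<Rightarrow> complex"
    and p q z zh :: complex
  assumes "bounded \<Omega>" "connected \<Omega>" "open \<Omega>"
    and "\<phi> holomorphic_on ball 0 1"
    and "covering_space (ball 0 1) \<phi> \<Omega>"
    and "p \<in> closure \<Omega>" "q \<in> closure \<Omega>" "z \<in> \<Omega>"
    and "zh \<in> ball 0 1" "\<phi> zh = z"
  shows
   "(\<forall>\<gamma> s0. path_epe \<Omega> p q \<gamma> \<and> s0 \<in> {0..1} \<and> \<gamma> s0 = z \<longrightarrow>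
      (\<exists>\<gamma>h. continuous_on {0..1} \<gamma>h \<and> \<gamma>h ` {0<..<1} \<subseteq> ball 0 1 \<and>
            (\<forall>s\<in>{0..1}. \<gamma>h s \<in> ext_dom \<phi> \<and> ext_phi \<phi> (\<gamma>h s) = \<gamma> s) \<and>
            \<gamma>h s0 = zh \<and>
            (\<forall>\<gamma>'. continuous_on {0..1} \<gamma>' \<and> \<gamma>' ` {0<..<1} \<subseteq> ball 0 1 \<and>
                  (\<forall>s\<in>{0..1}. \<gamma>' s \<in> ext_dom \<phi> \<and> ext_phi \<phi> (\<gamma>' s) = \<gamma> s) \<and>
                  \<gamma>' s0 = zh \<longrightarrow> (\<forall>s\<in>{0..1}. \<gamma>' s = \<gamma>h s))))
    \<and>
    (\<forall>(h :: real \<times> real \<Rightarrow> complex) s0.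
       continuous_on ({0..1} \<times> {0..1}) h \<and>
       (\<forall>t\<in>{0..1}. path_epe \<Omega> p q (\<lambda>s. h (s, t))) \<and>
       s0 \<in> {0..1} \<and> h (s0, 0) = z \<longrightarrow>
      (\<exists>hh. continuous_on ({0..1} \<times> {0..1}) hh \<and>
            hh ` ({0..1} \<times> {0..1}) \<subseteq> cball 0 1 \<and>
            (\<forall>s\<in>{0<..<1}. \<forall>t\<in>{0..1}. hh (s, t) \<in> ball 0 1 \<and> \<phi> (hh (s, t)) = h (s, t)) \<and>
            (\<exists>ph. hh ` ({0} \<times> {0..1}) = {ph} \<and> ph \<in> ext_dom \<phi> \<and> ext_phi \<phi> ph = p) \<and>
            (\<exists>qh. hh ` ({1} \<times> {0..1}) = {qh} \<and> qh \<in> ext_dom \<phi> \<and> ext_phi \<phi> qh = q) \<and>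
            hh (s0, 0) = zh \<and>
            (\<forall>hh'. continuous_on ({0..1} \<times> {0..1}) hh' \<and>
                   hh' ` ({0..1} \<times> {0..1}) \<subseteq> cball 0 1 \<and>
                   (\<forall>s\<in>{0<..<1}. \<forall>t\<in>{0..1}. hh' (s, t) \<in> ball 0 1 \<and> \<phi> (hh' (s, t)) = h (s, t)) \<and>
                   (\<exists>ph. hh' ` ({0} \<times> {0..1}) = {ph} \<and> ph \<in> ext_dom \<phi> \<and> ext_phi \<phi> ph = p) \<and>
                   (\<exists>qh. hh' ` ({1} \<times> {0..1}) = {qh} \<and> qh \<in> ext_dom \<phi> \<and> ext_phi \<phi> qh = q) \<and>
                   hh' (s0, 0) = zh \<longrightarrow>
                   (\<forall>x\<in>{0..1} \<times> {0..1}. hh' x = hh x))))"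
proof (intro conjI allI impI, goal_cases)
  case (1 \<gamma> s0)
  \<comment> \<open>The path is regarded as a homotopy that does not depend on
    \<open>t\<close>.\<close>
  define h where "h x = \<gamma> (fst x)" for x :: "real \<times> real"
  have \<gamma>: "continuous_on {0..1} \<gamma>" "\<gamma> 0 = p" "\<gamma> 1 = q" using 1 by (auto simp: path_epe_def)
  have hcont: "continuous_on ({0..1} \<times> {0..1}) h"
    unfolding h_def by (rule continuous_on_compose2[OF \<gamma>(1)]) (auto intro!: continuous_intros)
  have hpath: "\<forall>t\<in>{0..1}. path_epe \<Omega> p q (\<lambda>s. h (s, t))" using 1 by (simp add: h_def)
  have s0: "s0 \<in> {0..1}" "h (s0, 0) = z" using 1 by (auto simp: h_def)
  obtain hh ph qh where hh: "continuous_on ({0..1} \<times> {0..1}) hh"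
      "\<forall>s\<in>{0<..<1}. \<forall>t\<in>{0..1}. hh (s, t) \<in> ball 0 1 \<and> \<phi> (hh (s, t)) = h (s, t)"
      "hh (s0, 0) = zh"
    and ph: "hh ` ({0} \<times> {0..1}) = {ph}" "ph \<in> ext_dom \<phi>" "ext_phi \<phi> ph = p"
    and qh: "hh ` ({1} \<times> {0..1}) = {qh}" "qh \<in> ext_dom \<phi>" "ext_phi \<phi> qh = q"
    using homotopy_lift_ext[OF assms(1,4,5,8,9,10) hcont hpath s0] by (elim exE conjE) blast
  have ends: "hh (0, 0) = ph" "hh (1, 0) = qh" using ph(1) qh(1) by auto
  \<comment> \<open>The slice \<open>t = 0\<close> is taken because the base point condition is
    imposed at \<open>(s0, 0)\<close>.\<close>
  show ?case
  proof (rule exI[of _ "\<lambda>s. hh (s, 0)"], intro conjI allI impI ballI)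
    show "continuous_on {0..1} (\<lambda>s. hh (s, 0))"
      by (rule continuous_on_compose2[OF hh(1)]) (auto intro!: continuous_intros)
    show "(\<lambda>s. hh (s, 0)) ` {0<..<1} \<subseteq> ball 0 1" using hh(2) by auto
    fix s :: real assume s: "s \<in> {0..1}"
    have "hh (s, 0) \<in> ext_dom \<phi> \<and> ext_phi \<phi> (hh (s, 0)) = \<gamma> s"
    proof (cases "s \<in> {0<..<1}")
      case True
      then have "hh (s, 0) \<in> ball 0 1" "\<phi> (hh (s, 0)) = \<gamma> s" using hh(2) by (auto simp: h_def)
      then show ?thesis using ext_phi_ball by metis
    next
      case False
      then have "s = 0 \<or> s = 1" using s by auto
      then show ?thesis using ends ph qh \<gamma> by auto
    qed
    then show "hh (s, 0) \<in> ext_dom \<phi>" "ext_phi \<phi> (hh (s, 0)) = \<gamma> s" by auto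
  next
    fix \<gamma>' and s :: real
    assume \<gamma>': "continuous_on {0..1} \<gamma>' \<and> \<gamma>' ` {0<..<1} \<subseteq> ball 0 1 \<and>
                  (\<forall>s\<in>{0..1}. \<gamma>' s \<in> ext_dom \<phi> \<and> ext_phi \<phi> (\<gamma>' s) = \<gamma> s) \<and> \<gamma>' s0 = zh"
      and s: "s \<in> {0..1}"
    \<comment> \<open>A competing lift of the path is likewise made constant in \<open>t\<close>.
      Over the open strip it takes values in the disc, where \<open>ext_phi \<phi>\<close> is
      \<open>\<phi>\<close>, so uniqueness for homotopies applies.\<close>
    define f where "f x = \<gamma>' (fst x)" for x :: "real \<times> real"
    have "f (s, 0) = hh (s, 0)"
    proof (rule homotopy_lift_ext_unique[OF assms(5,8,9,10) hcont hpath s0 _ _ _ hh])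
      show "continuous_on ({0..1} \<times> {0..1}) f"
        unfolding f_def by (rule continuous_on_compose2[of "{0..1}" \<gamma>']) (use \<gamma>' in \<open>auto intro!: continuous_intros\<close>)
      show "\<forall>s\<in>{0<..<1}. \<forall>t\<in>{0..1}. f (s, t) \<in> ball 0 1 \<and> \<phi> (f (s, t)) = h (s, t)"
      proof (intro ballI)
        fix s t :: real assume st: "s \<in> {0<..<1}" "t \<in> {0..1}"
        then have "\<gamma>' s \<in> ball 0 1" "ext_phi \<phi> (\<gamma>' s) = \<gamma> s"
          using \<gamma>' by (blast, auto)
        then show "f (s, t) \<in> ball 0 1 \<and> \<phi> (f (s, t)) = h (s, t)"
          using ext_phi_ball[of "\<gamma>' s" \<phi>] by (simp add: h_def f_def)
      qed
    qed (use \<gamma>' s in \<open>auto simp: f_def\<close>)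
    then show "\<gamma>' s = hh (s, 0)" by (simp add: f_def)
  qed (use hh in auto)
next
  case (2 h s0)
  then have hcont: "continuous_on ({0..1} \<times> {0..1}) h"
    and hpath: "\<forall>t\<in>{0..1}. path_epe \<Omega> p q (\<lambda>s. h (s, t))"
    and s0: "s0 \<in> {0..1}" "h (s0, 0) = z" by auto
  obtain hh where hh: "continuous_on ({0..1} \<times> {0..1}) hh"
      "hh ` ({0..1} \<times> {0..1}) \<subseteq> cball 0 1"
      "\<forall>s\<in>{0<..<1}. \<forall>t\<in>{0..1}. hh (s, t) \<in> ball 0 1 \<and> \<phi> (hh (s, t)) = h (s, t)"
      "\<exists>ph. hh ` ({0} \<times> {0..1}) = {ph} \<and> ph \<in> ext_dom \<phi> \<and> ext_phi \<phi> ph = p"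
      "\<exists>qh. hh ` ({1} \<times> {0..1}) = {qh} \<and> qh \<in> ext_dom \<phi> \<and> ext_phi \<phi> qh = q"
      "hh (s0, 0) = zh"
    using homotopy_lift_ext[OF assms(1,4,5,8,9,10) hcont hpath s0] by (elim exE conjE) blast
  have uniq: "hh' x = hh x"
    if "continuous_on ({0..1} \<times> {0..1}) hh'"
      "\<forall>s\<in>{0<..<1}. \<forall>t\<in>{0..1}. hh' (s, t) \<in> ball 0 1 \<and> \<phi> (hh' (s, t)) = h (s, t)"
      "hh' (s0, 0) = zh" "x \<in> {0..1} \<times> {0..1}" for hh' x
    by (rule homotopy_lift_ext_unique[OF assms(5,8,9,10) hcont hpath s0 that(1-3) hh(1,3,6) that(4)])
  show ?case
    by (rule exI[of _ hh]) (use hh uniq in blast)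
qed

end
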